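(* Let $I\subset\mathbb R$ be an interval, $\alpha_0\in I$, and let $A,B:I\to\mathbb R$ with $B(\alpha)\neq0$ for all $\alpha\in I$. For $\alpha\in I$ let $G_\alpha$ be the bounded operator on $L^2(\mathbb R)$ obtained by density from $G_\alpha f(u)=\int_{\mathbb R}\hat f(\xi)e^{i[A(\alpha)\xi^2+B(\alpha)u\xi]}\,d\xi$ ($f$ Schwartz). Then $\lim_{\alpha\to\alpha_0}\|G_\alpha f-G_{\alpha_0}f\|_{L^2(\mathbb R)}=0$ for every $f\in L^2(\mathbb R)$ if and only if $A$ and $B$ are continuous at $\alpha_0$.
   Context: The Fourier transform is normalized as $\hat f(\xi)=\frac1{\sqrt{2\pi}}\int_{\mathbb R}e^{-i\xi t}f(t)\,dt$. *)

theory Defs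
  imports "HOL-Analysis.Analysis"
begin

definition L2 :: "(real \<Rightarrow> complex) set" where
  "L2 = {f. f \<in> borel_measurable lborel \<and> integrable lborel (\<lambda>x. (cmod (f x))^2)}"

definition L2norm :: "(real \<Rightarrow> complex) \<Rightarrow> real" where
  "L2norm f = sqrt (\<integral>x. (cmod (f x))^2 \<partial>lborel)"

definition vderiv :: "(real \<Rightarrow> complex) \<Rightarrow> real \<Rightarrow> complex" where
  "vderiv g = (\<lambda>y. vector_derivative g (at y))"

definition schwartz :: "(real \<Rightarrow> complex) \<Rightarrow> bool" where
  "schwartz f \<longleftrightarrow>
     (\<forall>n x. (vderiv ^^ n) f differentiable (at x)) \<and>
     (\<forall>k n. \<exists>C. \<forall>x. \<bar>x\<bar> ^ k * cmod (((vderiv ^^ n) f) x) \<le> C)"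

definition fourier :: "(real \<Rightarrow> complex) \<Rightarrow> real \<Rightarrow> complex" where
  "fourier f \<xi> = complex_of_real (1 / sqrt (2 * pi)) *
     (\<integral>t. exp (- (\<i> * complex_of_real (\<xi> * t))) * f t \<partial>lborel)"

definition Gpre :: "real \<Rightarrow> real \<Rightarrow> (real \<Rightarrow> complex) \<Rightarrow> real \<Rightarrow> complex" where
  "Gpre a b f u = (\<integral>\<xi>. fourier f \<xi> * exp (\<i> * complex_of_real (a * \<xi>^2 + b * u * \<xi>)) \<partial>lborel)"

text \<open>T is a bounded linear operator on L^2 (modulo a.e. equality) which agrees
  with Gpre a b on Schwartz functions; by density such T is unique up to a.e. equality,
  i.e. it is the operator "obtained by density".\<close>
definition is_G_operator :: "((real \<Rightarrow> complex) \<Rightarrow> real \<Rightarrow> complex) \<Rightarrow> real \<Rightarrow> real \<Rightarrow> bool" where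
  "is_G_operator T a b \<longleftrightarrow>
     (\<forall>f\<in>L2. T f \<in> L2) \<and>
     (\<forall>f\<in>L2. \<forall>g\<in>L2. \<forall>c::complex. AE x in lborel. T (\<lambda>y. f y + c * g y) x = T f x + c * T g x) \<and>
     (\<exists>C. \<forall>f\<in>L2. L2norm (T f) \<le> C * L2norm f) \<and>
     (\<forall>f. schwartz f \<longrightarrow> (AE u in lborel. T f u = Gpre a b f u))"

end

theory Submission
  imports Defs "HOL-Probability.Probability" "HOL-Real_Asymp.Real_Asymp" "HOL-Computational_Algebra.Polynomial"
begin

text \<open>
  On Schwartz functions \<open>G\<^sub>\<alpha>\<close> is the Fourier transform, multiplication by the unimodular function
  \<open>exp (i A \<xi>\<^sup>2)\<close>, a second Fourier integral and a dilation by \<open>B\<close>. Two applications of the Bessel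
  inequality for the Fourier integral bound the squared norm of \<open>G\<^sub>\<alpha>\<close> by a multiple of \<open>1 / |B|\<close>,
  first on Schwartz functions and then, by density, on all of \<open>L\<^sup>2\<close>. If \<open>A\<close> and \<open>B\<close> are continuous, this
  local uniformity reduces strong convergence to Schwartz functions, where it follows from dominated
  convergence for the factor \<open>exp (i A \<xi>\<^sup>2)\<close> and from the continuity of dilations on \<open>L\<^sup>2\<close>.

  Conversely, strong convergence implies weak convergence, and pairing with Gaussians is explicit:
  with \<open>z = (1 + B\<^sup>2) / 2 - i A\<close> and \<open>F = \<integral> exp (- z \<xi>\<^sup>2) d\<xi>\<close>, so that \<open>F\<^sup>2 = \<pi> / z\<close>, testing \<open>G\<^sub>\<alpha> h\<close>
  against \<open>h\<close> gives \<open>\<surd>(2 \<pi>) F\<close> for \<open>h t = exp (- t\<^sup>2 / 2)\<close> and \<open>\<surd>(2 \<pi>) B F / (2 z)\<close> for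
  \<open>h t = t exp (- t\<^sup>2 / 2)\<close>. The first limit determines \<open>z\<close>, hence \<open>A\<close> and \<open>|B|\<close>; the second one
  determines the sign of \<open>B\<close>.
\<close>

section \<open>Square-integrable functions\<close>

text \<open>Estimates are carried out with the squared norm: it is linear under domination and
  scales by \<open>1 / \<bar>c\<bar>\<close> under dilation. The price is a factor 2 in place of the
  triangle inequality, which affects constants only.\<close>

definition L2sq :: "(real \<Rightarrow> complex) \<Rightarrow> real" where
  "L2sq f = (\<integral>x. (cmod (f x))\<^sup>2 \<partial>lborel)"

lemma L2norm_eq_sqrt: "L2norm f = sqrt (L2sq f)"
  by (simp add: L2norm_def L2sq_def)

lemma L2sq_nonneg: "0 \<le> L2sq f"
  by (simp add: L2sq_def)

lemma L2norm_power2: "(L2norm f)\<^sup>2 = L2sq f"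
  by (simp add: L2norm_eq_sqrt L2sq_nonneg)

lemma L2norm_tendsto_0_iff:
  "((\<lambda>x. L2norm (f x)) \<longlongrightarrow> 0) F \<longleftrightarrow> ((\<lambda>x. L2sq (f x)) \<longlongrightarrow> 0) F"
proof
  assume "((\<lambda>x. L2norm (f x)) \<longlongrightarrow> 0) F"
  from tendsto_power[OF this, of 2] show "((\<lambda>x. L2sq (f x)) \<longlongrightarrow> 0) F"
    by (simp add: L2norm_power2)
next
  assume "((\<lambda>x. L2sq (f x)) \<longlongrightarrow> 0) F"
  from tendsto_real_sqrt[OF this] show "((\<lambda>x. L2norm (f x)) \<longlongrightarrow> 0) F"
    by (simp add: L2norm_eq_sqrt)
qed

lemma L2_measurable: "f \<in> L2 \<Longrightarrow> f \<in> borel_measurable borel"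
  by (simp add: L2_def)

lemma L2_integrable: "f \<in> L2 \<Longrightarrow> integrable lborel (\<lambda>x. (cmod (f x))\<^sup>2)"
  by (simp add: L2_def)

text \<open>From the triangle inequality and \<open>0 \<le> (cmod z - cmod w)^2\<close>, which
  bounds the mixed term.\<close>

lemma cmod_add_power2_le: "(cmod (z + w))\<^sup>2 \<le> 2 * (cmod z)\<^sup>2 + 2 * (cmod w)\<^sup>2"
proof -
  have "(cmod (z + w))\<^sup>2 \<le> (cmod z + cmod w)\<^sup>2"
    by (intro power_mono norm_triangle_ineq) simp
  also have "\<dots> \<le> 2 * (cmod z)\<^sup>2 + 2 * (cmod w)\<^sup>2"
    using zero_le_power2[of "cmod z - cmod w"] by (simp add: power2_eq_square algebra_simps)
  finally show ?thesis .
qed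

lemma cmod_diff_power2_le: "(cmod (z - w))\<^sup>2 \<le> 2 * (cmod z)\<^sup>2 + 2 * (cmod w)\<^sup>2"
  using cmod_add_power2_le[of z "- w"] by simp

lemma L2_dominated:
  assumes "f \<in> borel_measurable borel" "integrable lborel g" "\<And>x. (cmod (f x))\<^sup>2 \<le> g x"
  shows "f \<in> L2"
proof -
  have "(cmod (f x))\<^sup>2 \<le> \<bar>g x\<bar>" for x
    using assms(3)[of x] by linarith
  then show ?thesis
    unfolding L2_def using assms(1) by (auto intro!: Bochner_Integration.integrable_bound[OF assms(2)])
qed

lemma L2_add:
  assumes "f \<in> L2" "g \<in> L2" shows "(\<lambda>x. f x + g x) \<in> L2"
  using assms[THEN L2_measurable]
  by (intro L2_dominated[where g="\<lambda>x. 2 * (cmod (f x))\<^sup>2 + 2 * (cmod (g x))\<^sup>2"])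
     (auto intro!: assms[THEN L2_integrable] cmod_add_power2_le)

lemma L2_cmult:
  assumes "f \<in> L2" shows "(\<lambda>x. c * f x) \<in> L2"
  using assms by (auto simp: L2_def norm_mult power_mult_distrib)

lemma L2_diff:
  assumes "f \<in> L2" "g \<in> L2" shows "(\<lambda>x. f x - g x) \<in> L2"
  using L2_add[OF assms(1) L2_cmult[OF assms(2), of "-1"]] by simp

lemma L2sq_cmult: "L2sq (\<lambda>x. c * f x) = (cmod c)\<^sup>2 * L2sq f"
  by (simp add: L2sq_def norm_mult power_mult_distrib)

lemma L2sq_add_le:
  assumes "f \<in> L2" "g \<in> L2"
  shows "L2sq (\<lambda>x. f x + g x) \<le> 2 * L2sq f + 2 * L2sq g"
proof -
  have "L2sq (\<lambda>x. f x + g x) \<le> (\<integral>x. 2 * (cmod (f x))\<^sup>2 + 2 * (cmod (g x))\<^sup>2 \<partial>lborel)"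
    unfolding L2sq_def
    by (intro integral_mono) (auto intro!: assms[THEN L2_integrable] L2_add[OF assms, THEN L2_integrable] cmod_add_power2_le)
  also have "\<dots> = 2 * L2sq f + 2 * L2sq g"
    by (simp add: L2sq_def assms[THEN L2_integrable])
  finally show ?thesis .
qed

lemma L2sq_diff_commute: "L2sq (\<lambda>x. f x - g x) = L2sq (\<lambda>x. g x - f x)"
  by (simp add: L2sq_def norm_minus_commute)

lemma L2sq_diff_triangle:
  assumes "f \<in> L2" "g \<in> L2" "h \<in> L2"
  shows "L2sq (\<lambda>x. f x - h x) \<le> 2 * L2sq (\<lambda>x. f x - g x) + 2 * L2sq (\<lambda>x. g x - h x)"
  using L2sq_add_le[OF L2_diff[OF assms(1,2)] L2_diff[OF assms(2,3)]] by simp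

lemma L2sq_cong_AE:
  assumes "f \<in> borel_measurable borel" "g \<in> borel_measurable borel" "AE x in lborel. f x = g x"
  shows "L2sq f = L2sq g"
  unfolding L2sq_def using assms by (intro integral_cong_AE) auto

lemma nn_integral_eq_L2sq:
  assumes "f \<in> L2" shows "(\<integral>\<^sup>+x. ennreal ((cmod (f x))\<^sup>2) \<partial>lborel) = ennreal (L2sq f)"
  unfolding L2sq_def by (intro nn_integral_eq_integral L2_integrable assms) simp

text \<open>The form needed after Fatou's lemma, where integrability is not known beforehand and has
  to come out together with the bound.\<close>

lemma L2_nn_integralI:
  assumes "f \<in> borel_measurable borel" "(\<integral>\<^sup>+x. ennreal ((cmod (f x))\<^sup>2) \<partial>lborel) \<le> ennreal C" "0 \<le> C"
  shows "f \<in> L2" "L2sq f \<le> C"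
proof -
  show f: "f \<in> L2"
    unfolding L2_def using assms by (auto intro!: integrableI_bounded simp: le_less_trans)
  show "L2sq f \<le> C"
    using assms(2,3) by (simp add: nn_integral_eq_L2sq[OF f])
qed

lemma L2sq_dilation:
  assumes "c \<noteq> 0" shows "L2sq (\<lambda>x. f (c * x)) = L2sq f / \<bar>c\<bar>"
  using lborel_integral_real_affine[OF assms, of "\<lambda>x. (cmod (f x))\<^sup>2" 0] assms
  by (simp add: L2sq_def)

lemma L2_dilation:
  assumes "f \<in> L2" "c \<noteq> 0" shows "(\<lambda>x. f (c * x)) \<in> L2"
  using lborel_integrable_real_affine[OF L2_integrable[OF assms(1)] assms(2), of 0] L2_measurable[OF assms(1)]
  by (simp add: L2_def)

lemma L2_mult_integrable:
  assumes "f \<in> L2" "g \<in> L2" shows "integrable lborel (\<lambda>x. f x * g x)"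
proof (rule Bochner_Integration.integrable_bound)
  show "integrable lborel (\<lambda>x. (cmod (f x))\<^sup>2 + (cmod (g x))\<^sup>2)"
    by (intro Bochner_Integration.integrable_add assms[THEN L2_integrable])
  show "(\<lambda>x. f x * g x) \<in> borel_measurable lborel"
    using assms[THEN L2_measurable] by simp
  have "cmod (f x) * cmod (g x) \<le> (cmod (f x))\<^sup>2 + (cmod (g x))\<^sup>2" for x
    using zero_le_power2[of "cmod (f x) - cmod (g x)"] mult_nonneg_nonneg[OF norm_ge_zero norm_ge_zero, of "f x" "g x"]
    by (simp add: power2_eq_square algebra_simps del: zero_le_mult_iff mult_nonneg_nonneg)
  then show "AE x in lborel. norm (f x * g x) \<le> norm ((cmod (f x))\<^sup>2 + (cmod (g x))\<^sup>2)"
    by (auto simp: norm_mult)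
qed

text \<open>Cauchy-Schwarz for the bilinear pairing without conjugation, obtained from the version
  for nonnegative integrals.\<close>

lemma cmod_integral_mult_power2_le:
  assumes "f \<in> L2" "g \<in> L2"
  shows "(cmod (\<integral>x. f x * g x \<partial>lborel))\<^sup>2 \<le> L2sq f * L2sq g"
proof -
  note [measurable] = assms[THEN L2_measurable]
  have "ennreal ((cmod (\<integral>x. f x * g x \<partial>lborel))\<^sup>2) = (ennreal (cmod (\<integral>x. f x * g x \<partial>lborel)))\<^sup>2"
    by (simp add: ennreal_power)
  also have "\<dots> \<le> (\<integral>\<^sup>+x. ennreal (cmod (f x * g x)) \<partial>lborel)\<^sup>2"
    by (intro power_mono integral_norm_bound_ennreal L2_mult_integrable assms) simp_all
  also have "\<dots> = (\<integral>\<^sup>+x. ennreal (cmod (f x)) * ennreal (cmod (g x)) \<partial>lborel)\<^sup>2"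
    by (simp add: norm_mult ennreal_mult)
  also have "\<dots> \<le> (\<integral>\<^sup>+x. (ennreal (cmod (f x)))\<^sup>2 \<partial>lborel) * (\<integral>\<^sup>+x. (ennreal (cmod (g x)))\<^sup>2 \<partial>lborel)"
    by (intro Cauchy_Schwarz_nn_integral) auto
  also have "\<dots> = ennreal (L2sq f * L2sq g)"
    by (simp add: ennreal_power nn_integral_eq_L2sq assms ennreal_mult L2sq_nonneg)
  finally show ?thesis by (simp add: L2sq_nonneg)
qed

section \<open>The Bessel inequality for the Fourier integral\<close>

text \<open>Positive sign and no normalization, so that one transform serves twice:
  \<open>fourier\<close> is a multiple of it after reflection, and \<open>Gpre\<close> is this
  transform of \<open>chirp\<close>, dilated by \<open>b\<close>.\<close>

definition ft :: "(real \<Rightarrow> complex) \<Rightarrow> real \<Rightarrow> complex" where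
  "ft \<phi> u = (\<integral>\<xi>. \<phi> \<xi> * exp (\<i> * complex_of_real (u * \<xi>)) \<partial>lborel)"

lemma ft_measurable [measurable]:
  assumes [measurable]: "\<phi> \<in> borel_measurable borel"
  shows "ft \<phi> \<in> borel_measurable borel"
  unfolding ft_def by measurable

lemma integrable_mult_exp_i:
  assumes "integrable lborel (\<phi> :: real \<Rightarrow> complex)" "h \<in> borel_measurable borel"
  shows "integrable lborel (\<lambda>\<xi>. \<phi> \<xi> * exp (\<i> * complex_of_real (h \<xi>)))"
  by (rule Bochner_Integration.integrable_bound[OF assms(1)])
     (use assms borel_measurable_integrable[OF assms(1)] in \<open>auto simp: norm_mult simp del: of_real_mult\<close>)

lemma cmod_ft_le: "cmod (ft \<phi> u) \<le> (\<integral>\<xi>. cmod (\<phi> \<xi>) \<partial>lborel)"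
proof -
  have "cmod (ft \<phi> u) \<le> (\<integral>\<xi>. cmod (\<phi> \<xi> * exp (\<i> * complex_of_real (u * \<xi>))) \<partial>lborel)"
    unfolding ft_def by (rule integral_norm_bound)
  then show ?thesis by (simp add: norm_mult del: of_real_mult)
qed

lemma integrable_mult_ft:
  assumes "integrable lborel \<phi>" "integrable lborel \<psi>"
  shows "integrable lborel (\<lambda>u. \<psi> u * ft \<phi> (b * u))"
proof (rule Bochner_Integration.integrable_bound)
  show "integrable lborel (\<lambda>u. cmod (\<psi> u) * (\<integral>\<xi>. cmod (\<phi> \<xi>) \<partial>lborel))"
    using assms by simp
  note [measurable] = assms[THEN borel_measurable_integrable]
  show "(\<lambda>u. \<psi> u * ft \<phi> (b * u)) \<in> borel_measurable lborel"
    by measurable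
  show "AE u in lborel. norm (\<psi> u * ft \<phi> (b * u)) \<le> norm (cmod (\<psi> u) * (\<integral>\<xi>. cmod (\<phi> \<xi>) \<partial>lborel))"
    by (auto simp: norm_mult abs_mult intro!: mult_left_mono order_trans[OF cmod_ft_le])
qed

text \<open>Fubini: the phase \<open>b * u * \<xi>\<close> is symmetric in the two variables, and
  the kernel has modulus \<open>cmod (\<phi> \<xi>) * cmod (\<psi> u)\<close>, which is integrable
  on the product.\<close>

lemma ft_multiplication_formula:
  assumes "integrable lborel \<phi>" "integrable lborel \<psi>"
  shows "(\<integral>u. ft \<phi> (b * u) * \<psi> u \<partial>lborel) = (\<integral>\<xi>. \<phi> \<xi> * ft \<psi> (b * \<xi>) \<partial>lborel)"
proof -
  note [measurable] = assms[THEN borel_measurable_integrable]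
  define k where "k \<xi> u = \<phi> \<xi> * \<psi> u * exp (\<i> * complex_of_real (b * u * \<xi>))" for \<xi> u
  have [measurable]: "(\<lambda>p. k (fst p) (snd p)) \<in> borel_measurable (lborel \<Otimes>\<^sub>M lborel)"
    unfolding k_def by measurable
  have nk: "cmod (k \<xi> u) = cmod (\<phi> \<xi>) * cmod (\<psi> u)" for \<xi> u
    by (simp add: k_def norm_mult del: of_real_mult)
  have int: "integrable (lborel \<Otimes>\<^sub>M lborel) (case_prod k)"
  proof (rule lborel_pair.Fubini_integrable)
    show "case_prod k \<in> borel_measurable (lborel \<Otimes>\<^sub>M lborel)"
      by (simp add: split_beta')
    show "integrable lborel (\<lambda>x. \<integral>y. norm (case (x, y) of (x, y) \<Rightarrow> k x y) \<partial>lborel)"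
      using assms by (simp add: nk)
    have "integrable lborel (k x)" for x
      unfolding k_def using assms
      by (intro integrable_mult_exp_i integrable_mult_right) auto
    then show "AE x in lborel. integrable lborel (\<lambda>y. case (x, y) of (x, y) \<Rightarrow> k x y)"
      by simp
  qed
  have "(\<integral>u. ft \<phi> (b * u) * \<psi> u \<partial>lborel) = (\<integral>u. (\<integral>\<xi>. k \<xi> u \<partial>lborel) \<partial>lborel)"
    unfolding ft_def k_def integral_mult_left_zero[symmetric]
    by (intro Bochner_Integration.integral_cong refl) (simp add: mult_ac)
  also have "\<dots> = (\<integral>\<xi>. (\<integral>u. k \<xi> u \<partial>lborel) \<partial>lborel)"
    by (rule lborel_pair.Fubini_integral[OF int])
  also have "\<dots> = (\<integral>\<xi>. \<phi> \<xi> * ft \<psi> (b * \<xi>) \<partial>lborel)"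
    unfolding ft_def k_def integral_mult_right_zero[symmetric]
    by (intro Bochner_Integration.integral_cong refl) (simp add: mult_ac)
  finally show ?thesis .
qed

text \<open>Normalized to value 1 at the origin rather than to mass 1, so that it tends to 1
  pointwise as \<open>s\<close> grows.\<close>

definition gauss :: "real \<Rightarrow> real \<Rightarrow> complex" where
  "gauss s u = complex_of_real (exp (- (u / s)\<^sup>2 / 2))"

lemma gauss_measurable [measurable]: "gauss s \<in> borel_measurable borel"
  unfolding gauss_def by measurable

lemma gauss_eq_normal_density:
  "s > 0 \<Longrightarrow> gauss s u = complex_of_real (s * sqrt (2 * pi) * normal_density 0 s u)"
  by (simp add: gauss_def normal_density_def power_divide real_sqrt_mult)

lemma integrable_gauss:
  assumes "s > 0" shows "integrable lborel (gauss s)"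
proof -
  have "gauss s = (\<lambda>u. complex_of_real (s * sqrt (2 * pi) * normal_density 0 s u))"
    using gauss_eq_normal_density[OF assms] by blast
  then show ?thesis using assms by (simp del: of_real_mult)
qed

text \<open>The substitution \<open>u = s * v\<close> reduces this to the characteristic function of
  the standard normal distribution.\<close>

lemma ft_gauss:
  assumes s: "s > 0"
  shows "ft (gauss s) x = complex_of_real (s * sqrt (2 * pi) * exp (- (s * x)\<^sup>2 / 2))"
proof -
  have std: "(\<integral>u. exp (\<i> * complex_of_real (y * u)) * std_normal_density u \<partial>lborel) = exp (- y\<^sup>2 / 2)" for y
  proof -
    have "char std_normal_distribution y = (\<integral>u. std_normal_density u *\<^sub>R exp (\<i> * complex_of_real (y * u)) \<partial>lborel)"
      unfolding char_def by (subst integral_density) auto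
    then show ?thesis
      by (simp add: char_std_normal_distribution scaleR_conv_of_real mult.commute)
  qed
  have "ft (gauss s) x = \<bar>s\<bar> *\<^sub>R (\<integral>u. gauss s (0 + s * u) * exp (\<i> * complex_of_real (x * (0 + s * u))) \<partial>lborel)"
    unfolding ft_def using s by (intro lborel_integral_real_affine) simp
  also have "\<dots> = s *\<^sub>R (\<integral>u. sqrt (2 * pi) *\<^sub>R (exp (\<i> * complex_of_real ((s * x) * u)) * std_normal_density u) \<partial>lborel)"
    using s by (intro arg_cong2[where f=scaleR] Bochner_Integration.integral_cong)
      (auto simp: gauss_def normal_density_def scaleR_conv_of_real mult_ac)
  also have "\<dots> = s *\<^sub>R sqrt (2 * pi) *\<^sub>R complex_of_real (exp (- (s * x)\<^sup>2 / 2))"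
    by (subst integral_scaleR_right) (simp only: std)
  finally show ?thesis by (simp add: scaleR_conv_of_real)
qed

text \<open>Testing against the Gaussian weight \<open>gauss s\<close> turns \<open>\<integral> |ft \<phi>|\<^sup>2\<close> into a double integral against
  an approximate identity of mass \<open>2 \<pi>\<close>; AM-GM on \<open>|\<phi> \<xi>| |\<phi> \<eta>|\<close> bounds it uniformly in \<open>s\<close>.\<close>
lemma ft_weighted_bound:
  assumes \<phi>1: "integrable lborel \<phi>" and \<phi>2: "\<phi> \<in> L2" and s: "s > 0"
  shows "(\<integral>\<^sup>+u. ennreal ((cmod (ft \<phi> u))\<^sup>2 * exp (- (u / s)\<^sup>2 / 2)) \<partial>lborel) \<le> ennreal (2 * pi * L2sq \<phi>)"
proof -
  note [measurable] = borel_measurable_integrable[OF \<phi>1]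
  \<comment> \<open>\<open>\<psi>\<close> is chosen so that \<open>ft \<phi> u * \<psi> u\<close> is
    the weighted square to be integrated; \<open>W\<close> is the transform of the weight
    \<open>gauss s\<close>.\<close>
  define \<psi> where "\<psi> u = cnj (ft \<phi> u) * gauss s u" for u
  define W where "W x = s * sqrt (2 * pi) * exp (- (s * x)\<^sup>2 / 2)" for x
  have [measurable]: "W \<in> borel_measurable borel" unfolding W_def by measurable
  have W0: "W x \<ge> 0" for x using s by (simp add: W_def)
  \<comment> \<open>Up to the factor \<open>2 * pi\<close>, the translate of \<open>W\<close> is the
    normal density with mean \<open>\<xi>\<close> and deviation \<open>1 / s\<close>; its mass is
    therefore the same for all \<open>s\<close>.\<close>
  have W_int: "(\<integral>\<^sup>+\<eta>. ennreal (W (\<eta> - \<xi>)) \<partial>lborel) = ennreal (2 * pi)" for \<xi>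
  proof -
    have W_eq: "W (\<eta> - \<xi>) = 2 * pi * normal_density \<xi> (1 / s) \<eta>" for \<eta>
    proof -
      have "normal_density \<xi> (1 / s) \<eta> = s / sqrt (2 * pi) * exp (- (s * (\<eta> - \<xi>))\<^sup>2 / 2)"
        using s by (simp add: normal_density_def power_divide power_mult_distrib real_sqrt_divide mult.commute)
      moreover have "W (\<eta> - \<xi>) = s * (2 * pi / sqrt (2 * pi)) * exp (- (s * (\<eta> - \<xi>))\<^sup>2 / 2)"
        by (subst real_div_sqrt) (simp_all add: W_def)
      ultimately show ?thesis
        by simp
    qed
    have "(\<integral>\<^sup>+\<eta>. ennreal (2 * pi * normal_density \<xi> (1 / s) \<eta>) \<partial>lborel)
        = ennreal (\<integral>\<eta>. 2 * pi * normal_density \<xi> (1 / s) \<eta> \<partial>lborel)"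
      using s by (intro nn_integral_eq_integral) auto
    then show ?thesis using s by (simp add: W_eq)
  qed
  have W_sym: "W (\<eta> - \<xi>) = W (\<xi> - \<eta>)" for \<xi> \<eta>
    by (simp add: W_def power_mult_distrib power2_commute[of \<xi> \<eta>])
  have int_\<psi>: "integrable lborel \<psi>"
  proof -
    have "integrable lborel (\<lambda>u. cnj (gauss s u * ft \<phi> (1 * u)))"
      by (intro integrable_cnj integrable_mult_ft \<phi>1 integrable_gauss s)
    then show ?thesis by (simp add: \<psi>_def[abs_def] gauss_def mult.commute)
  qed
  have ft_\<psi>: "ft \<psi> \<xi> = cnj (\<integral>\<eta>. \<phi> \<eta> * complex_of_real (W (\<eta> - \<xi>)) \<partial>lborel)" for \<xi>
  proof -
    \<comment> \<open>Modulating the Gaussian by \<open>- \<xi>\<close> translates its transform to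
      \<open>W (\<eta> - \<xi>)\<close>; the multiplication formula then writes
      \<open>ft \<psi>\<close> as the conjugate of a smoothing of \<open>\<phi>\<close>.\<close>
    define g where "g u = gauss s u * exp (\<i> * complex_of_real (- \<xi> * u))" for u
    have g: "integrable lborel g"
      unfolding g_def by (intro integrable_mult_exp_i integrable_gauss s) simp
    have ft_g: "ft g \<eta> = complex_of_real (W (\<eta> - \<xi>))" for \<eta>
    proof -
      have "ft g \<eta> = ft (gauss s) (\<eta> - \<xi>)"
        unfolding ft_def g_def
        by (intro Bochner_Integration.integral_cong refl) (simp add: algebra_simps flip: exp_add)
      then show ?thesis by (simp add: ft_gauss[OF s] W_def)
    qed
    have "ft \<psi> \<xi> = (\<integral>u. cnj (ft \<phi> (1 * u) * g u) \<partial>lborel)"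
      unfolding ft_def[of \<psi>] \<psi>_def g_def
      by (intro Bochner_Integration.integral_cong refl) (simp add: gauss_def mult_ac exp_cnj)
    also have "\<dots> = cnj (\<integral>u. ft \<phi> (1 * u) * g u \<partial>lborel)"
      by (rule Bochner_Integration.integral_cnj)
    finally show ?thesis
      using ft_multiplication_formula[OF \<phi>1 g, of 1] by (simp add: ft_g)
  qed
  have "(\<integral>\<^sup>+u. ennreal ((cmod (ft \<phi> u))\<^sup>2 * exp (- (u / s)\<^sup>2 / 2)) \<partial>lborel)
      = (\<integral>\<^sup>+u. ennreal (cmod (ft \<phi> (1 * u) * \<psi> u)) \<partial>lborel)"
    by (intro nn_integral_cong) (simp add: \<psi>_def gauss_def norm_mult power2_eq_square mult_ac)
  also have "\<dots> = ennreal (\<integral>u. cmod (ft \<phi> (1 * u) * \<psi> u) \<partial>lborel)"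
    using integrable_mult_ft[OF \<phi>1 int_\<psi>, of 1]
    by (intro nn_integral_eq_integral) (auto simp: mult.commute)
  \<comment> \<open>The integrand is real and nonnegative, so the modulus can be pulled out of the
    integral; only then does the multiplication formula apply.\<close>
  also have "(\<integral>u. cmod (ft \<phi> (1 * u) * \<psi> u) \<partial>lborel) = cmod (\<integral>u. ft \<phi> (1 * u) * \<psi> u \<partial>lborel)"
  proof -
    have "ft \<phi> u * \<psi> u = complex_of_real (cmod (ft \<phi> u * \<psi> u))" for u
    proof -
      have "ft \<phi> u * \<psi> u = (ft \<phi> u * cnj (ft \<phi> u)) * gauss s u"
        by (simp add: \<psi>_def)
      also have "\<dots> = complex_of_real ((cmod (ft \<phi> u))\<^sup>2 * exp (- (u / s)\<^sup>2 / 2))"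
        by (subst complex_norm_square[symmetric]) (simp add: gauss_def)
      finally have eq: "ft \<phi> u * \<psi> u = complex_of_real ((cmod (ft \<phi> u))\<^sup>2 * exp (- (u / s)\<^sup>2 / 2))" .
      show ?thesis unfolding eq norm_of_real by simp
    qed
    then have "(\<integral>u. ft \<phi> u * \<psi> u \<partial>lborel) = (\<integral>u. complex_of_real (cmod (ft \<phi> u * \<psi> u)) \<partial>lborel)"
      by metis
    then show ?thesis by simp
  qed
  also have "\<dots> = cmod (\<integral>\<xi>. \<phi> \<xi> * ft \<psi> \<xi> \<partial>lborel)"
    using ft_multiplication_formula[OF \<phi>1 int_\<psi>, of 1] by simp
  also have "ennreal \<dots> \<le> (\<integral>\<^sup>+\<xi>. ennreal (cmod (\<phi> \<xi> * ft \<psi> \<xi>)) \<partial>lborel)"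
    using integrable_mult_ft[OF int_\<psi> \<phi>1, of 1] by (intro integral_norm_bound_ennreal) simp
  also have "\<dots> \<le> (\<integral>\<^sup>+\<xi>. (\<integral>\<^sup>+\<eta>. ennreal (cmod (\<phi> \<xi>) * (cmod (\<phi> \<eta>) * W (\<eta> - \<xi>))) \<partial>lborel) \<partial>lborel)"
  proof (intro nn_integral_mono)
    fix \<xi> :: real
    have int: "integrable lborel (\<lambda>\<eta>. \<phi> \<eta> * complex_of_real (W (\<eta> - \<xi>)))"
    proof (rule Bochner_Integration.integrable_bound)
      show "integrable lborel (\<lambda>\<eta>. cmod (\<phi> \<eta>) * (s * sqrt (2 * pi)))"
        using \<phi>1 by simp
      show "AE \<eta> in lborel. norm (\<phi> \<eta> * complex_of_real (W (\<eta> - \<xi>))) \<le> norm (cmod (\<phi> \<eta>) * (s * sqrt (2 * pi)))"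
        using s by (auto simp: norm_mult W_def abs_mult intro!: mult_left_mono)
    qed measurable
    have "ennreal (cmod (\<phi> \<xi> * ft \<psi> \<xi>)) = ennreal (cmod (\<phi> \<xi>)) * ennreal (cmod (\<integral>\<eta>. \<phi> \<eta> * complex_of_real (W (\<eta> - \<xi>)) \<partial>lborel))"
      by (simp add: ft_\<psi> norm_mult ennreal_mult)
    also have "\<dots> \<le> ennreal (cmod (\<phi> \<xi>)) * (\<integral>\<^sup>+\<eta>. ennreal (cmod (\<phi> \<eta> * complex_of_real (W (\<eta> - \<xi>)))) \<partial>lborel)"
      by (intro mult_left_mono integral_norm_bound_ennreal int) simp
    also have "\<dots> = (\<integral>\<^sup>+\<eta>. ennreal (cmod (\<phi> \<xi>) * (cmod (\<phi> \<eta>) * W (\<eta> - \<xi>))) \<partial>lborel)"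
      by (subst nn_integral_cmult[symmetric]) (auto simp: norm_mult ennreal_mult W0)
    finally show "ennreal (cmod (\<phi> \<xi> * ft \<psi> \<xi>)) \<le> (\<integral>\<^sup>+\<eta>. ennreal (cmod (\<phi> \<xi>) * (cmod (\<phi> \<eta>) * W (\<eta> - \<xi>))) \<partial>lborel)" .
  qed
  also have "\<dots> \<le> (\<integral>\<^sup>+\<xi>. (\<integral>\<^sup>+\<eta>. ennreal ((cmod (\<phi> \<xi>))\<^sup>2 / 2) * ennreal (W (\<eta> - \<xi>)) +
      ennreal ((cmod (\<phi> \<eta>))\<^sup>2 / 2) * ennreal (W (\<eta> - \<xi>)) \<partial>lborel) \<partial>lborel)"
  proof (intro nn_integral_mono)
    fix \<xi> \<eta> :: real
    have "cmod (\<phi> \<xi>) * cmod (\<phi> \<eta>) \<le> (cmod (\<phi> \<xi>))\<^sup>2 / 2 + (cmod (\<phi> \<eta>))\<^sup>2 / 2"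
      using zero_le_power2[of "cmod (\<phi> \<xi>) - cmod (\<phi> \<eta>)"] by (simp add: power2_eq_square algebra_simps)
    from mult_right_mono[OF this W0[of "\<eta> - \<xi>"]]
    show "ennreal (cmod (\<phi> \<xi>) * (cmod (\<phi> \<eta>) * W (\<eta> - \<xi>))) \<le> ennreal ((cmod (\<phi> \<xi>))\<^sup>2 / 2) * ennreal (W (\<eta> - \<xi>)) +
      ennreal ((cmod (\<phi> \<eta>))\<^sup>2 / 2) * ennreal (W (\<eta> - \<xi>))"
      using W0 by (simp add: algebra_simps flip: ennreal_plus ennreal_mult)
  qed
  also have "\<dots> = (\<integral>\<^sup>+\<xi>. (\<integral>\<^sup>+\<eta>. ennreal ((cmod (\<phi> \<xi>))\<^sup>2 / 2) * ennreal (W (\<eta> - \<xi>)) \<partial>lborel) \<partial>lborel)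
     + (\<integral>\<^sup>+\<xi>. (\<integral>\<^sup>+\<eta>. ennreal ((cmod (\<phi> \<eta>))\<^sup>2 / 2) * ennreal (W (\<eta> - \<xi>)) \<partial>lborel) \<partial>lborel)"
    by (simp add: nn_integral_add)
  \<comment> \<open>Swapping the variables by Tonelli and using that \<open>W\<close> is even turns
    the second summand into the first. Each contributes half of the mass
    \<open>2 * pi\<close>.\<close>
  also have "(\<integral>\<^sup>+\<xi>. (\<integral>\<^sup>+\<eta>. ennreal ((cmod (\<phi> \<eta>))\<^sup>2 / 2) * ennreal (W (\<eta> - \<xi>)) \<partial>lborel) \<partial>lborel)
     = (\<integral>\<^sup>+\<eta>. (\<integral>\<^sup>+\<xi>. ennreal ((cmod (\<phi> \<eta>))\<^sup>2 / 2) * ennreal (W (\<eta> - \<xi>)) \<partial>lborel) \<partial>lborel)"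
    by (rule lborel_pair.Fubini') measurable
  also have "(\<lambda>\<eta>. (\<integral>\<^sup>+\<xi>. ennreal ((cmod (\<phi> \<eta>))\<^sup>2 / 2) * ennreal (W (\<eta> - \<xi>)) \<partial>lborel))
     = (\<lambda>\<xi>. (\<integral>\<^sup>+\<eta>. ennreal ((cmod (\<phi> \<xi>))\<^sup>2 / 2) * ennreal (W (\<eta> - \<xi>)) \<partial>lborel))"
    by (subst W_sym) simp
  also have "(\<integral>\<^sup>+\<xi>. (\<integral>\<^sup>+\<eta>. ennreal ((cmod (\<phi> \<xi>))\<^sup>2 / 2) * ennreal (W (\<eta> - \<xi>)) \<partial>lborel) \<partial>lborel)
      = (\<integral>\<^sup>+\<xi>. ennreal ((cmod (\<phi> \<xi>))\<^sup>2) * ennreal pi \<partial>lborel)"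
    by (simp add: nn_integral_cmult W_int flip: ennreal_mult)
  also have "\<dots> = ennreal (pi * L2sq \<phi>)"
    by (subst nn_integral_multc) (simp_all add: nn_integral_eq_L2sq[OF \<phi>2] ennreal_mult mult.commute L2sq_nonneg)
  also have "ennreal (pi * L2sq \<phi>) + ennreal (pi * L2sq \<phi>) = ennreal (2 * pi * L2sq \<phi>)"
    by (simp add: L2sq_nonneg flip: ennreal_plus)
  finally show ?thesis .
qed

text \<open>The bound in \<open>ft_weighted_bound\<close> is the same for every \<open>s\<close>.
  Along \<open>s = Suc n\<close>, which is always positive, the weights tend to 1, and Fatou's lemma
  passes to the limit.\<close>

lemma ft_L2:
  assumes \<phi>1: "integrable lborel \<phi>" and \<phi>2: "\<phi> \<in> L2"
  shows "ft \<phi> \<in> L2" and "L2sq (ft \<phi>) \<le> 2 * pi * L2sq \<phi>"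
proof -
  note [measurable] = borel_measurable_integrable[OF \<phi>1]
  let ?F = "\<lambda>n u. ennreal ((cmod (ft \<phi> u))\<^sup>2 * exp (- (u / real (Suc n))\<^sup>2 / 2))"
  have "(\<lambda>n. ?F n u) \<longlonglongrightarrow> ennreal ((cmod (ft \<phi> u))\<^sup>2)" for u
  proof -
    have "(\<lambda>n. u / real (Suc n)) \<longlonglongrightarrow> 0"
      by (intro tendsto_divide_0[OF tendsto_const] filterlim_at_top_imp_at_infinity
          filterlim_compose[OF filterlim_real_sequentially filterlim_Suc])
    then have "(\<lambda>n. (cmod (ft \<phi> u))\<^sup>2 * exp (- (u / real (Suc n))\<^sup>2 / 2)) \<longlonglongrightarrow> (cmod (ft \<phi> u))\<^sup>2 * exp (- (0\<^sup>2) / 2)"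
      by (intro tendsto_intros) auto
    then show ?thesis by (intro tendsto_ennrealI) simp
  qed
  then have "liminf (\<lambda>n. ?F n u) = ennreal ((cmod (ft \<phi> u))\<^sup>2)" for u
    by (intro lim_imp_Liminf) auto
  then have "(\<integral>\<^sup>+u. ennreal ((cmod (ft \<phi> u))\<^sup>2) \<partial>lborel) = (\<integral>\<^sup>+u. liminf (\<lambda>n. ?F n u) \<partial>lborel)"
    by simp
  also have "\<dots> \<le> liminf (\<lambda>n. \<integral>\<^sup>+u. ?F n u \<partial>lborel)"
    by (rule nn_integral_liminf) measurable
  also have "\<dots> \<le> liminf (\<lambda>n. ennreal (2 * pi * L2sq \<phi>))"
    by (intro Liminf_mono always_eventually allI ft_weighted_bound assms) simp
  finally have "(\<integral>\<^sup>+u. ennreal ((cmod (ft \<phi> u))\<^sup>2) \<partial>lborel) \<le> ennreal (2 * pi * L2sq \<phi>)"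
    by (simp add: Liminf_const)
  then show "ft \<phi> \<in> L2" and "L2sq (ft \<phi>) \<le> 2 * pi * L2sq \<phi>"
    by (auto intro!: L2_nn_integralI mult_nonneg_nonneg L2sq_nonneg)
qed

section \<open>Density of Schwartz functions\<close>

lemma integrable_inverse_1_plus_power2: "integrable lborel (\<lambda>x::real. 1 / (1 + x\<^sup>2))"
  using integrable_inverse_1_plus_square by (simp add: set_integrable_def divide_inverse einterval_def)

lemma schwartz_vderiv:
  assumes "schwartz f" shows "schwartz (vderiv f)"
proof -
  have eq: "(vderiv ^^ n) (vderiv f) = (vderiv ^^ Suc n) f" for n
    by (simp only: funpow_Suc_right o_apply)
  show ?thesis
    using assms unfolding schwartz_def eq by blast
qed

lemma schwartz_has_vector_derivative:
  assumes "schwartz f" shows "(f has_vector_derivative vderiv f x) (at x)"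
  using assms unfolding schwartz_def vderiv_def
  by (metis funpow_0 vector_derivative_works)

lemma schwartz_isCont: "schwartz f \<Longrightarrow> isCont f x"
  using schwartz_has_vector_derivative has_vector_derivative_continuous by blast

lemma schwartz_measurable: "schwartz f \<Longrightarrow> f \<in> borel_measurable borel"
  by (intro borel_measurable_continuous_onI) (simp add: schwartz_isCont continuous_at_imp_continuous_on)

text \<open>The sum of the defining bounds for the exponents 0 and 2; it supplies an integrable
  majorant.\<close>

lemma schwartz_decay:
  assumes "schwartz f" obtains C where "C \<ge> 0" "\<And>x. cmod (f x) \<le> C * (1 / (1 + x\<^sup>2))"
proof -
  have "\<exists>C. \<forall>x. \<bar>x\<bar> ^ k * cmod (((vderiv ^^ 0) f) x) \<le> C" for k
    using assms unfolding schwartz_def by blast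
  then have ex: "\<exists>C. \<forall>x. \<bar>x\<bar> ^ k * cmod (f x) \<le> C" for k
    by simp
  from ex[of 0] obtain C where C: "\<And>x. cmod (f x) \<le> C" by auto
  from ex[of 2] obtain D where D: "\<And>x. x\<^sup>2 * cmod (f x) \<le> D" by auto
  have "0 \<le> C" "0 \<le> D" using order_trans[OF norm_ge_zero C[of 0]] D[of 0] by auto
  show thesis
  proof
    show "0 \<le> C + D" using \<open>0 \<le> C\<close> \<open>0 \<le> D\<close> by simp
    fix x :: real
    have "0 < 1 + x\<^sup>2" by (simp add: add_pos_nonneg)
    moreover have "(1 + x\<^sup>2) * cmod (f x) \<le> C + D"
      using C[of x] D[of x] by (simp add: algebra_simps)
    ultimately show "cmod (f x) \<le> (C + D) * (1 / (1 + x\<^sup>2))"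
      by (simp add: pos_le_divide_eq mult.commute)
  qed
qed

lemma schwartz_integrable:
  assumes "schwartz f" shows "integrable lborel f"
proof -
  obtain C where C: "C \<ge> 0" "\<And>x. cmod (f x) \<le> C * (1 / (1 + x\<^sup>2))"
    using schwartz_decay[OF assms] by blast
  show ?thesis
  proof (rule Bochner_Integration.integrable_bound)
    show "integrable lborel (\<lambda>x. C * (1 / (1 + x\<^sup>2)))"
      by (intro integrable_mult_right integrable_inverse_1_plus_power2)
    have "cmod (f x) \<le> \<bar>C * (1 / (1 + x\<^sup>2))\<bar>" for x
      using C(2)[of x] by linarith
    then show "AE x in lborel. norm (f x) \<le> norm (C * (1 / (1 + x\<^sup>2)))"
      by simp
  qed (use schwartz_measurable[OF assms] in simp)
qed

lemma bounded_integrable_imp_L2: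
  assumes "integrable lborel f" "\<And>x. cmod (f x) \<le> C"
  shows "f \<in> L2"
proof (rule L2_dominated)
  show "f \<in> borel_measurable borel" using assms(1) by simp
  show "integrable lborel (\<lambda>x. C * cmod (f x))" using assms(1) by simp
  show "(cmod (f x))\<^sup>2 \<le> C * cmod (f x)" for x
    using assms(2)[of x] by (simp add: power2_eq_square mult_right_mono)
qed

lemma schwartz_L2:
  assumes "schwartz f" shows "f \<in> L2"
proof -
  obtain C where C: "C \<ge> 0" "\<And>x. cmod (f x) \<le> C * (1 / (1 + x\<^sup>2))"
    using schwartz_decay[OF assms] by blast
  have "C * (1 / (1 + x\<^sup>2)) \<le> C" for x :: real
    using C(1) add_pos_nonneg[OF zero_less_one zero_le_power2[of x]]
    by (intro mult_left_le) (auto simp: divide_le_eq_1)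
  with C(2) show ?thesis
    by (intro bounded_integrable_imp_L2[OF schwartz_integrable[OF assms]]) (blast intro: order_trans)
qed

lemma schwartz_tendsto_0:
  assumes "schwartz f"
  shows "(f \<longlongrightarrow> 0) at_top" "(f \<longlongrightarrow> 0) at_bot"
proof -
  obtain C where C: "C \<ge> 0" "\<And>x. cmod (f x) \<le> C * (1 / (1 + x\<^sup>2))"
    using schwartz_decay[OF assms] by blast
  have "((\<lambda>x::real. C * (1 / (1 + x\<^sup>2))) \<longlongrightarrow> 0) at_top" "((\<lambda>x::real. C * (1 / (1 + x\<^sup>2))) \<longlongrightarrow> 0) at_bot"
    by real_asymp+
  then show "(f \<longlongrightarrow> 0) at_top" "(f \<longlongrightarrow> 0) at_bot"
    using C(2) by (auto intro!: Lim_null_comparison[where g="\<lambda>x. C * (1 / (1 + x\<^sup>2))"] always_eventually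
        simp del: mult_1_right times_divide_eq_right)
qed

lemma schwartz_add_cmult:
  assumes "schwartz f" "schwartz g"
  shows "schwartz (\<lambda>x. f x + c * g x)"
proof -
  have df: "(vderiv ^^ n) f differentiable (at x)" and dg: "(vderiv ^^ n) g differentiable (at x)" for n x
    using assms by (auto simp: schwartz_def)
  have eq: "(vderiv ^^ n) (\<lambda>x. f x + c * g x) = (\<lambda>x. (vderiv ^^ n) f x + c * (vderiv ^^ n) g x)" for n
  proof (induction n)
    case (Suc n)
    have "((\<lambda>x. (vderiv ^^ n) f x + c * (vderiv ^^ n) g x) has_vector_derivative
        vderiv ((vderiv ^^ n) f) x + c * vderiv ((vderiv ^^ n) g) x) (at x)" for x
      unfolding vderiv_def[of "(vderiv ^^ n) _"]
      by (intro derivative_intros has_vector_derivative_mult_right vector_derivative_works[THEN iffD1] df dg)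
    from vector_derivative_at[OF this] show ?case
      by (simp add: Suc vderiv_def[of "\<lambda>x. (vderiv ^^ n) f x + c * (vderiv ^^ n) g x"])
  qed simp
  show ?thesis
    unfolding schwartz_def eq
  proof (intro conjI allI)
    fix n x show "(\<lambda>x. (vderiv ^^ n) f x + c * (vderiv ^^ n) g x) differentiable (at x)"
      by (intro derivative_intros df dg)
  next
    fix k n
    obtain C D where C: "\<And>x. \<bar>x\<bar> ^ k * cmod ((vderiv ^^ n) f x) \<le> C" and D: "\<And>x. \<bar>x\<bar> ^ k * cmod ((vderiv ^^ n) g x) \<le> D"
      using assms unfolding schwartz_def by metis
    have "\<bar>x\<bar> ^ k * cmod ((vderiv ^^ n) f x + c * (vderiv ^^ n) g x) \<le> C + cmod c * D" for x
    proof -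
      have "cmod ((vderiv ^^ n) f x + c * (vderiv ^^ n) g x) \<le> cmod ((vderiv ^^ n) f x) + cmod c * cmod ((vderiv ^^ n) g x)"
        using norm_triangle_ineq[of "(vderiv ^^ n) f x" "c * (vderiv ^^ n) g x"] by (simp add: norm_mult)
      then have "\<bar>x\<bar> ^ k * cmod ((vderiv ^^ n) f x + c * (vderiv ^^ n) g x) \<le>
        \<bar>x\<bar> ^ k * (cmod ((vderiv ^^ n) f x) + cmod c * cmod ((vderiv ^^ n) g x))"
        by (intro mult_left_mono) auto
      also have "\<dots> = \<bar>x\<bar> ^ k * cmod ((vderiv ^^ n) f x) + cmod c * (\<bar>x\<bar> ^ k * cmod ((vderiv ^^ n) g x))"
        by (simp add: algebra_simps)
      also have "\<dots> \<le> C + cmod c * D"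
        by (intro add_mono C mult_left_mono D) simp
      finally show ?thesis .
    qed
    then show "\<exists>C. \<forall>x. \<bar>x\<bar> ^ k * cmod ((vderiv ^^ n) f x + c * (vderiv ^^ n) g x) \<le> C"
      by blast
  qed
qed

section \<open>A supply of Schwartz functions: polynomials times exponentials of polynomials\<close>

definition pexp :: "real poly \<Rightarrow> real poly \<Rightarrow> real \<Rightarrow> complex" where
  "pexp p q x = complex_of_real (poly p x * exp (- poly q x))"

lemma pexp_has_vector_derivative:
  "(pexp p q has_vector_derivative pexp (pderiv p - p * pderiv q) q x) (at x)"
proof -
  have "((\<lambda>x. poly p x * exp (- poly q x)) has_real_derivative
      poly (pderiv p - p * pderiv q) x * exp (- poly q x)) (at x)"
    by (auto intro!: derivative_eq_intros simp: algebra_simps)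
  then show ?thesis
    unfolding pexp_def[abs_def]
    by (intro bounded_linear.has_vector_derivative[OF bounded_linear_of_real])
       (simp add: has_real_derivative_iff_has_vector_derivative)
qed

lemma vderiv_pexp: "vderiv (pexp p q) = pexp (pderiv p - p * pderiv q) q"
  by (rule ext) (simp add: vderiv_def vector_derivative_at[OF pexp_has_vector_derivative])

text \<open>Differentiation changes only the polynomial factor, so a decay bound valid for every
  \<open>p\<close> controls all derivatives at once.\<close>

lemma vderiv_funpow_pexp: "\<exists>p'. (vderiv ^^ n) (pexp p q) = pexp p' q"
proof (induction n)
  case 0
  show ?case by (auto intro: exI[of _ p])
next
  case (Suc n)
  then obtain p' where "(vderiv ^^ n) (pexp p q) = pexp p' q" by blast
  then show ?case by (auto simp: vderiv_pexp)
qed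

text \<open>A single term of the exponential series gives
  \<open>(c * x^2) ^ k / fact k \<le> exp (c * x^2)\<close>, and
  \<open>\<bar>x\<bar> ^ k \<le> 1 + (x^2) ^ k\<close> reduces odd powers to even ones.\<close>

lemma power_exp_bounded:
  fixes c :: real assumes "c > 0"
  shows "\<exists>C. \<forall>x. \<bar>x\<bar> ^ k * exp (- c * x\<^sup>2) \<le> C"
proof (intro exI allI)
  fix x :: real
  have "(c * x\<^sup>2) ^ k / fact k \<le> exp (c * x\<^sup>2)"
    using assms sum_le_suminf[OF summable_exp, of "{k}" "c * x\<^sup>2"]
    by (simp add: exp_def scaleR_conv_of_real divide_inverse mult.commute)
  then have 1: "x\<^sup>2 ^ k \<le> fact k / c ^ k * exp (c * x\<^sup>2)"
    using assms by (simp add: power_mult_distrib field_simps)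
  have "\<bar>x\<bar> ^ k \<le> 1 + (x\<^sup>2) ^ k"
  proof (cases "\<bar>x\<bar> \<le> 1")
    case True
    then have "\<bar>x\<bar> ^ k \<le> 1" by (simp add: power_le_one)
    then show ?thesis by (simp add: add_increasing2)
  next
    case False
    then have "\<bar>x\<bar> ^ k \<le> \<bar>x\<bar> ^ (2 * k)" by (intro power_increasing) auto
    also have "\<dots> = (x\<^sup>2) ^ k" by (simp add: power_mult)
    finally show ?thesis by simp
  qed
  also have "\<dots> \<le> exp (c * x\<^sup>2) + fact k / c ^ k * exp (c * x\<^sup>2)"
    using 1 assms by (intro add_mono) auto
  also have "\<dots> = (1 + fact k / c ^ k) * exp (c * x\<^sup>2)"
    by (simp add: algebra_simps)
  finally show "\<bar>x\<bar> ^ k * exp (- c * x\<^sup>2) \<le> 1 + fact k / c ^ k"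
    by (simp add: exp_minus field_simps)
qed

text \<open>Induction on the coefficients. The exponent \<open>k\<close> is kept arbitrary because
  the factor \<open>x\<close> in front of the remaining polynomial is absorbed into
  \<open>\<bar>x\<bar> ^ Suc k\<close>.\<close>

lemma poly_exp_bounded:
  fixes c :: real assumes "c > 0"
  shows "\<exists>C. \<forall>x. \<bar>x\<bar> ^ k * \<bar>poly p x\<bar> * exp (- c * x\<^sup>2) \<le> C"
proof (induction p arbitrary: k)
  case 0
  show ?case by (auto intro: exI[of _ 0])
next
  case (pCons a p)
  obtain C where C: "\<And>x. \<bar>x\<bar> ^ k * exp (- c * x\<^sup>2) \<le> C"
    using power_exp_bounded[OF assms] by blast
  obtain D where D: "\<And>x. \<bar>x\<bar> ^ Suc k * \<bar>poly p x\<bar> * exp (- c * x\<^sup>2) \<le> D"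
    using pCons.IH by blast
  have "\<bar>x\<bar> ^ k * \<bar>poly (pCons a p) x\<bar> * exp (- c * x\<^sup>2) \<le> \<bar>a\<bar> * C + D" for x
  proof -
    have "\<bar>poly (pCons a p) x\<bar> \<le> \<bar>a\<bar> + \<bar>x\<bar> * \<bar>poly p x\<bar>"
      using abs_triangle_ineq[of a "x * poly p x"] by (simp add: abs_mult)
    then have "\<bar>x\<bar> ^ k * \<bar>poly (pCons a p) x\<bar> * exp (- c * x\<^sup>2) \<le> \<bar>x\<bar> ^ k * (\<bar>a\<bar> + \<bar>x\<bar> * \<bar>poly p x\<bar>) * exp (- c * x\<^sup>2)"
      by (intro mult_right_mono mult_left_mono) auto
    also have "\<dots> = \<bar>a\<bar> * (\<bar>x\<bar> ^ k * exp (- c * x\<^sup>2)) + \<bar>x\<bar> ^ Suc k * \<bar>poly p x\<bar> * exp (- c * x\<^sup>2)"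
      by (simp add: algebra_simps)
    also have "\<dots> \<le> \<bar>a\<bar> * C + D"
      by (intro add_mono mult_left_mono C D) simp
    finally show ?thesis .
  qed
  then show ?case by blast
qed

text \<open>A quadratic lower bound on \<open>q\<close> compares the function with a Gaussian; the
  offset \<open>d\<close> costs the factor \<open>exp d\<close>. It leaves room for exponents of
  high degree that are flat near their centre.\<close>

lemma schwartz_pexp:
  assumes "c > 0" "\<And>x. c * x\<^sup>2 - d \<le> poly q x"
  shows "schwartz (pexp p q)"
  unfolding schwartz_def
proof (intro conjI allI)
  fix n x
  show "(vderiv ^^ n) (pexp p q) differentiable (at x)"
    using vderiv_funpow_pexp[of n p q] pexp_has_vector_derivative differentiableI_vector by metis
next
  fix k n
  obtain p' where p': "(vderiv ^^ n) (pexp p q) = pexp p' q"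
    using vderiv_funpow_pexp by blast
  obtain C where C: "\<And>x. \<bar>x\<bar> ^ k * \<bar>poly p' x\<bar> * exp (- c * x\<^sup>2) \<le> C"
    using poly_exp_bounded[OF assms(1)] by blast
  have "\<bar>x\<bar> ^ k * cmod (pexp p' q x) \<le> C * exp d" for x
  proof -
    have "exp (- poly q x) \<le> exp (- c * x\<^sup>2 + d)"
      using assms(2)[of x] by simp
    then have "\<bar>x\<bar> ^ k * \<bar>poly p' x\<bar> * exp (- poly q x) \<le> \<bar>x\<bar> ^ k * \<bar>poly p' x\<bar> * exp (- c * x\<^sup>2 + d)"
      by (intro mult_left_mono) auto
    also have "\<dots> = (\<bar>x\<bar> ^ k * \<bar>poly p' x\<bar> * exp (- c * x\<^sup>2)) * exp d"
      by (subst exp_add) simp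
    also have "\<dots> \<le> C * exp d"
      by (intro mult_right_mono C) simp
    finally show ?thesis
      by (simp add: pexp_def norm_mult abs_mult mult.assoc del: of_real_mult)
  qed
  then show "\<exists>C. \<forall>x. \<bar>x\<bar> ^ k * cmod ((vderiv ^^ n) (pexp p q) x) \<le> C"
    unfolding p' by blast
qed

section \<open>The closure of the Schwartz functions: intervals, bounded Borel sets, all of
  L2\<close>

lemma L2sq_dominated_convergence:
  assumes [measurable]: "\<And>n. s n \<in> borel_measurable borel" "f \<in> borel_measurable borel"
    and lim: "AE x in lborel. (\<lambda>n. s n x) \<longlonglongrightarrow> f x"
    and w: "integrable lborel w" "\<And>n x. (cmod (s n x))\<^sup>2 \<le> w x" "\<And>x. (cmod (f x))\<^sup>2 \<le> w x"
  shows "(\<lambda>n. L2sq (\<lambda>x. f x - s n x)) \<longlonglongrightarrow> 0"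
proof -
  have "(\<lambda>n. L2sq (\<lambda>x. f x - s n x)) \<longlonglongrightarrow> (\<integral>x. 0 \<partial>(lborel :: real measure))"
    unfolding L2sq_def
  proof (rule integral_dominated_convergence)
    \<comment> \<open>The constant 4 is 2 + 2, from bounding the square of a difference by twice the
      sum of the squares.\<close>
    show "integrable lborel (\<lambda>x. 4 * w x)" using w by simp
    show "AE x in lborel. (\<lambda>n. (cmod (f x - s n x))\<^sup>2) \<longlonglongrightarrow> 0"
      using lim
    proof eventually_elim
      case (elim x)
      from tendsto_power[OF tendsto_norm[OF tendsto_diff[OF tendsto_const elim, of "f x"]], of 2]
      show ?case by simp
    qed
    show "AE x in lborel. norm ((cmod (f x - s n x))\<^sup>2) \<le> 4 * w x" for n
    proof (intro AE_I2)
      fix x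
      show "norm ((cmod (f x - s n x))\<^sup>2) \<le> 4 * w x"
        using cmod_diff_power2_le[of "f x" "s n x"] w(2)[of n x] w(3)[of x] by simp
    qed
  qed measurable
  then show ?thesis by simp
qed

text \<open>Membership in the L2 closure of the Schwartz functions, as a predicate whose stability
  under linear combinations and dominated limits can be proved step by step.\<close>

definition approximable :: "(real \<Rightarrow> complex) \<Rightarrow> bool" where
  "approximable f \<longleftrightarrow> f \<in> L2 \<and> (\<forall>e>0. \<exists>g. schwartz g \<and> L2sq (\<lambda>x. f x - g x) < e)"

lemma approximable_L2: "approximable f \<Longrightarrow> f \<in> L2"
  by (simp add: approximable_def)

lemma approximable_schwartz: "schwartz f \<Longrightarrow> approximable f"
  unfolding approximable_def by (auto intro!: exI[of _ f] schwartz_L2 simp: L2sq_def)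

lemma approximable_add_cmult:
  assumes f: "approximable f" and g: "approximable g"
  shows "approximable (\<lambda>x. f x + c * g x)"
  unfolding approximable_def
proof (intro conjI allI impI)
  show "(\<lambda>x. f x + c * g x) \<in> L2"
    using f g by (intro L2_add L2_cmult approximable_L2)
  fix e :: real assume e: "e > 0"
  obtain f' where f': "schwartz f'" "L2sq (\<lambda>x. f x - f' x) < e / 4"
    using f e unfolding approximable_def by (metis divide_pos_pos zero_less_numeral)
  \<comment> \<open>The summand 1 in the denominator covers the case \<open>c = 0\<close>.\<close>
  have "0 < e / (4 * (1 + (cmod c)\<^sup>2))" using e by (simp add: add_pos_nonneg)
  then obtain g' where g': "schwartz g'" "L2sq (\<lambda>x. g x - g' x) < e / (4 * (1 + (cmod c)\<^sup>2))"
    using g unfolding approximable_def by metis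
  have "L2sq (\<lambda>x. (f x - f' x) + c * (g x - g' x)) \<le> 2 * L2sq (\<lambda>x. f x - f' x) + 2 * L2sq (\<lambda>x. c * (g x - g' x))"
    using f g f' g' by (intro L2sq_add_le L2_cmult L2_diff approximable_L2 schwartz_L2)
  also have "L2sq (\<lambda>x. c * (g x - g' x)) = (cmod c)\<^sup>2 * L2sq (\<lambda>x. g x - g' x)"
    by (rule L2sq_cmult)
  also have "\<dots> \<le> (1 + (cmod c)\<^sup>2) * L2sq (\<lambda>x. g x - g' x)"
    by (intro mult_right_mono L2sq_nonneg) simp
  also have "2 * L2sq (\<lambda>x. f x - f' x) + 2 * ((1 + (cmod c)\<^sup>2) * L2sq (\<lambda>x. g x - g' x)) < 2 * (e / 4) + 2 * (e / 4)"
  proof -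
    have "0 < 1 + (cmod c)\<^sup>2" by (simp add: add_pos_nonneg)
    then have "(1 + (cmod c)\<^sup>2) * L2sq (\<lambda>x. g x - g' x) < e / 4"
      using g'(2) by (simp add: field_simps)
    with f'(2) show ?thesis by linarith
  qed
  finally have "L2sq (\<lambda>x. (f x - f' x) + c * (g x - g' x)) < e" by simp
  then have "L2sq (\<lambda>x. (f x + c * g x) - (f' x + c * g' x)) < e"
    by (simp add: algebra_simps)
  then show "\<exists>h. schwartz h \<and> L2sq (\<lambda>x. f x + c * g x - h x) < e"
    using schwartz_add_cmult[OF f'(1) g'(1), of c] by blast
qed

lemma approximable_zero: "approximable (\<lambda>x. 0)"
proof -
  have "schwartz (pexp 0 [:0, 0, 1:])"
    by (rule schwartz_pexp[of 1 0]) (auto simp: power2_eq_square)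
  then show ?thesis
    using approximable_schwartz by (simp add: pexp_def[abs_def])
qed

lemma approximable_sum:
  assumes "finite Y" "\<And>y. y \<in> Y \<Longrightarrow> approximable (h y)"
  shows "approximable (\<lambda>x. \<Sum>y\<in>Y. c y * h y x)"
  using assms
proof (induction Y rule: finite_induct)
  case (insert y Y)
  then have "approximable (\<lambda>x. (\<Sum>y\<in>Y. c y * h y x) + c y * h y x)"
    by (intro approximable_add_cmult) auto
  with insert show ?case by (simp add: add.commute)
qed (simp add: approximable_zero)

lemma approximable_dominated:
  assumes s: "\<And>n. approximable (s n)" and f[measurable]: "f \<in> borel_measurable borel"
    and lim: "AE x in lborel. (\<lambda>n. s n x) \<longlonglongrightarrow> f x"
    and w: "integrable lborel w" "\<And>n x. (cmod (s n x))\<^sup>2 \<le> w x" "\<And>x. (cmod (f x))\<^sup>2 \<le> w x"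
  shows "approximable f"
  unfolding approximable_def
proof (intro conjI allI impI)
  show f2: "f \<in> L2" by (rule L2_dominated[OF f w(1,3)])
  fix e :: real assume "e > 0"
  have "(\<lambda>n. L2sq (\<lambda>x. f x - s n x)) \<longlonglongrightarrow> 0"
    by (rule L2sq_dominated_convergence[OF L2_measurable[OF approximable_L2[OF s]] f lim w])
  from order_tendstoD(2)[OF this, of "e / 4"] \<open>e > 0\<close>
  obtain n where n: "L2sq (\<lambda>x. f x - s n x) < e / 4"
    by (auto simp: eventually_sequentially)
  obtain g where g: "schwartz g" "L2sq (\<lambda>x. s n x - g x) < e / 4"
    using s[of n] \<open>e > 0\<close> unfolding approximable_def by (metis divide_pos_pos zero_less_numeral)
  have "L2sq (\<lambda>x. f x - g x) \<le> 2 * L2sq (\<lambda>x. f x - s n x) + 2 * L2sq (\<lambda>x. s n x - g x)"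
    by (intro L2sq_diff_triangle f2 approximable_L2 s schwartz_L2 g)
  with n g have "L2sq (\<lambda>x. f x - g x) < e" by linarith
  with g(1) show "\<exists>g. schwartz g \<and> L2sq (\<lambda>x. f x - g x) < e" by blast
qed

text \<open>The indicator of an interval is the pointwise limit of \<open>exp (- ((x - c) / r) ^ (2 * m))\<close>.\<close>
lemma approximable_indicator_Ioc: "approximable (indicator {a<..b})"
proof (cases "a < b")
  case False
  then have "indicator {a<..b} = (\<lambda>x::real. 0 :: complex)" by (auto simp: fun_eq_iff)
  then show ?thesis by (simp add: approximable_zero)
next
  case True
  define c where "c = (a + b) / 2"
  define r where "r = (b - a) / 2"
  have r: "r > 0" using True by (simp add: r_def)
  define y where "y x = (x - c) / r" for x
  \<comment> \<open>\<open>Suc m\<close> keeps the exponent at least 2, as the quadratic lower bound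
    requires.\<close>
  define q where "q m = [:- c / r, 1 / r:] ^ (2 * Suc m)" for m
  have poly_q: "poly (q m) x = y x ^ (2 * Suc m)" for m x
    by (simp add: q_def y_def diff_divide_distrib poly_power del: power_Suc mult_Suc_right)
  define s where "s m = pexp 1 (q m)" for m
  have s_eq: "s m x = complex_of_real (exp (- (y x ^ (2 * Suc m))))" for m x
    by (simp only: s_def pexp_def poly_q poly_1 mult_1)
  \<comment> \<open>This comparison, uniform in \<open>m\<close>, serves both purposes below: it
    makes each \<open>s m\<close> Schwartz and bounds all of them by a multiple of
    \<open>s 0\<close>.\<close>
  have y_pow: "(y x)\<^sup>2 \<le> 1 + y x ^ (2 * Suc m)" for m x
  proof (cases "\<bar>y x\<bar> \<le> 1")
    case True
    then have "(y x)\<^sup>2 \<le> 1" by (simp add: abs_square_le_1)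
    moreover have "0 \<le> y x ^ (2 * Suc m)" by (rule zero_le_even_power) simp
    ultimately show ?thesis by linarith
  next
    case False
    then have "\<bar>y x\<bar> ^ 2 \<le> \<bar>y x\<bar> ^ (2 * Suc m)" by (intro power_increasing) auto
    also have "\<dots> = y x ^ (2 * Suc m)" by (rule power_even_abs) simp
    finally show ?thesis by simp
  qed
  have schwartz_s: "schwartz (s m)" for m
    unfolding s_def
  proof (rule schwartz_pexp)
    show "0 < 1 / (2 * r\<^sup>2)" using r by simp
    fix x
    have "x\<^sup>2 \<le> 2 * (x - c)\<^sup>2 + 2 * c\<^sup>2"
      using zero_le_power2[of "x - 2 * c"] by (simp add: power2_eq_square algebra_simps)
    then have "x\<^sup>2 / (2 * r\<^sup>2) \<le> (2 * (x - c)\<^sup>2 + 2 * c\<^sup>2) / (2 * r\<^sup>2)"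
      using r by (intro divide_right_mono) auto
    also have "\<dots> = (y x)\<^sup>2 + c\<^sup>2 / r\<^sup>2"
      using r by (simp add: y_def power_divide add_divide_distrib)
    finally show "1 / (2 * r\<^sup>2) * x\<^sup>2 - (1 + c\<^sup>2 / r\<^sup>2) \<le> poly (q m) x"
      using y_pow[of x m] by (simp add: poly_q del: power_Suc mult_Suc_right)
  qed
  show ?thesis
  proof (rule approximable_dominated)
    show "approximable (s m)" for m by (intro approximable_schwartz schwartz_s)
    \<comment> \<open>By \<open>y_pow\<close>, \<open>s m\<close> is at most \<open>exp 1\<close>
      times \<open>s 0\<close>; squaring gives the factor \<open>exp 2\<close>.\<close>
    show "integrable lborel (\<lambda>x. exp 2 * (cmod (s 0 x))\<^sup>2)"
      by (intro integrable_mult_right L2_integrable schwartz_L2 schwartz_s)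
    show "(cmod (s m x))\<^sup>2 \<le> exp 2 * (cmod (s 0 x))\<^sup>2" for m x
    proof -
      have "exp (- (y x ^ (2 * Suc m))) \<le> exp (1 - (y x)\<^sup>2)"
        using y_pow[of x m] by (simp del: power_Suc mult_Suc_right)
      then have "(exp (- (y x ^ (2 * Suc m))))\<^sup>2 \<le> (exp (1 - (y x)\<^sup>2))\<^sup>2"
        by (intro power_mono) auto
      also have "\<dots> = exp 2 * (exp (- (y x)\<^sup>2))\<^sup>2"
        by (simp add: power2_eq_square flip: exp_add)
      finally show ?thesis by (simp add: s_eq del: power_Suc mult_Suc_right) (simp add: numeral_2_eq_2)
    qed
    show "(cmod (indicator {a<..b} x))\<^sup>2 \<le> exp 2 * (cmod (s 0 x))\<^sup>2" for x
    proof (cases "x \<in> {a<..b}")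
      case True
      then have "\<bar>x - c\<bar> \<le> r" by (auto simp: abs_le_iff field_simps c_def r_def)
      then have "\<bar>y x\<bar> \<le> 1" using r by (simp add: y_def abs_divide)
      then have "(y x)\<^sup>2 \<le> 1" by (simp add: abs_square_le_1)
      have "1 = exp 2 * (exp (- 1 :: real))\<^sup>2"
        by (simp add: power2_eq_square flip: exp_add)
      also have "\<dots> \<le> exp 2 * (exp (- (y x)\<^sup>2))\<^sup>2"
        using \<open>(y x)\<^sup>2 \<le> 1\<close> by (intro mult_left_mono power_mono) auto
      finally show ?thesis using True by (simp add: s_eq power2_eq_square)
    qed simp
    \<comment> \<open>At the endpoints \<open>\<bar>y x\<bar> = 1\<close>, and \<open>s m\<close>
      has the constant value \<open>exp (- 1)\<close> there; they form a null set.\<close>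
    have "AE x in lborel. x \<noteq> a" "AE x in lborel. x \<noteq> b"
      by (rule AE_lborel_singleton)+
    then show "AE x in lborel. (\<lambda>m. s m x) \<longlonglongrightarrow> indicator {a<..b} x"
    proof eventually_elim
      case (elim x)
      have even: "(y x) ^ (2 * Suc m) = ((y x)\<^sup>2) ^ Suc m" for m
        by (rule power_mult)
      show ?case
      proof (cases "x \<in> {a<..b}")
        case True
        then have "\<bar>x - c\<bar> < r" using elim by (auto simp: abs_less_iff field_simps c_def r_def)
        then have "\<bar>y x\<bar> < 1" using r by (simp add: y_def abs_divide)
        then have "(y x)\<^sup>2 < 1" by (simp add: abs_square_less_1)
        then have "(\<lambda>m. ((y x)\<^sup>2) ^ Suc m) \<longlonglongrightarrow> 0"
          by (intro LIMSEQ_Suc LIMSEQ_power_zero) simp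
        then have "(\<lambda>m. exp (- (((y x)\<^sup>2) ^ Suc m))) \<longlonglongrightarrow> exp (- 0)"
          by (intro tendsto_intros)
        then have "(\<lambda>m. complex_of_real (exp (- (((y x)\<^sup>2) ^ Suc m)))) \<longlonglongrightarrow> complex_of_real (exp (- 0))"
          by (rule tendsto_of_real)
        then show ?thesis using True by (simp add: s_eq even del: power_Suc mult_Suc_right)
      next
        case False
        then have "r < \<bar>x - c\<bar>" using elim True by (auto simp: abs_if field_simps c_def r_def)
        then have "1 < \<bar>y x\<bar>" using r by (simp add: y_def abs_divide)
        then have "1 < (y x)\<^sup>2" by (metis one_less_power power2_abs zero_less_numeral)
        then have lim: "(\<lambda>m. inverse (((y x)\<^sup>2) ^ Suc m)) \<longlonglongrightarrow> 0"
          by (intro LIMSEQ_Suc LIMSEQ_inverse_realpow_zero)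
        have bd: "norm (exp (- (((y x)\<^sup>2) ^ Suc m))) \<le> inverse (((y x)\<^sup>2) ^ Suc m)" for m
        proof -
          have "0 < ((y x)\<^sup>2) ^ Suc m"
            using \<open>1 < (y x)\<^sup>2\<close> by (meson less_trans zero_less_one zero_less_power)
          moreover have "((y x)\<^sup>2) ^ Suc m \<le> exp (((y x)\<^sup>2) ^ Suc m)"
            using exp_ge_add_one_self[of "((y x)\<^sup>2) ^ Suc m"] by linarith
          ultimately show ?thesis by (simp add: exp_minus le_imp_inverse_le del: power_Suc)
        qed
        have "(\<lambda>m. exp (- (((y x)\<^sup>2) ^ Suc m))) \<longlonglongrightarrow> 0"
          by (rule Lim_null_comparison[OF always_eventually[OF allI[OF bd]] lim])
        then have "(\<lambda>m. complex_of_real (exp (- (((y x)\<^sup>2) ^ Suc m)))) \<longlonglongrightarrow> complex_of_real 0"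
          by (rule tendsto_of_real)
        then show ?thesis using False by (simp add: s_eq even del: power_Suc mult_Suc_right)
      qed
    qed
  qed measurable
qed

text \<open>Dynkin's argument from the half-open intervals, which are stable under intersection.
  Cutting with the fixed interval \<open>{a<..b}\<close> keeps everything in L2: complements become
  differences, and \<open>indicator {a<..b}\<close> dominates the countable unions.\<close>

lemma approximable_indicator:
  assumes "A \<in> sets borel"
  shows "approximable (indicator (A \<inter> {a<..b}))"
proof -
  let ?G = "range (\<lambda>(a, b). {a <.. b::real})"
  have "Int_stable ?G"
    unfolding Int_stable_def
  proof (intro ballI)
    fix A B assume "A \<in> ?G" "B \<in> ?G"
    then obtain a b c d where "A = {a<..b}" "B = {c<..d}" by auto
    then have "A \<inter> B = (case (max a c, min b d) of (a, b) \<Rightarrow> {a<..b})" by auto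
    then show "A \<inter> B \<in> ?G" by blast
  qed
  moreover have "?G \<subseteq> Pow UNIV" by simp
  moreover have gen: "sigma_sets UNIV ?G = sets borel"
    by (subst borel_sigma_sets_Ioc) simp
  from assms have "A \<in> sigma_sets UNIV ?G" unfolding gen .
  ultimately show ?thesis
  proof (induction rule: sigma_sets_induct_disjoint)
    case (basic A)
    then obtain c d where "A = {c<..d}" by auto
    then have "A \<inter> {a<..b} = {max c a<..min d b}" by auto
    then show ?case by (simp add: approximable_indicator_Ioc)
  next
    case empty
    show ?case by (simp add: approximable_zero)
  next
    case (compl A)
    have "indicator ((UNIV - A) \<inter> {a<..b}) = (\<lambda>x. indicator {a<..b} x + (-1) * indicator (A \<inter> {a<..b}) x :: complex)"
      by (auto simp: fun_eq_iff indicator_def)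
    then show ?case
      using approximable_add_cmult[OF approximable_indicator_Ioc compl.IH, of a b "-1"] by simp
  next
    case (union A)
    define D where "D i = A i \<inter> {a<..b}" for i
    have [measurable]: "A i \<in> sets borel" for i using union.hyps(2) unfolding gen by blast
    have fin: "approximable (indicator (\<Union>i<n. D i))" for n :: nat
    proof (induction n)
      case (Suc n)
      have "D i \<inter> D n = {}" if "i < n" for i
        using disjoint_family_onD[OF union.hyps(1), of i n] that by (auto simp: D_def)
      then have "(\<Union>i<n. D i) \<inter> D n = {}" by blast
      then have "indicator (\<Union>i<Suc n. D i) = (\<lambda>x. indicator (\<Union>i<n. D i) x + 1 * indicator (D n) x :: complex)"
        by (auto simp: fun_eq_iff lessThan_Suc indicator_def)
      then show ?case
        using approximable_add_cmult[OF Suc union.IH[of n], of 1] by (simp add: D_def)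
    qed (simp add: approximable_zero)
    have "approximable (indicator (\<Union>i. D i))"
    proof (rule approximable_dominated[OF fin])
      show "indicator (\<Union>i. D i) \<in> borel_measurable borel" unfolding D_def by measurable
      show "AE x in lborel. (\<lambda>n. indicator (\<Union>i<n. D i) x :: complex) \<longlonglongrightarrow> indicator (\<Union>i. D i) x"
        by (intro AE_I2 LIMSEQ_indicator_UN)
      show "integrable lborel (indicator {a<..b} :: real \<Rightarrow> real)"
        by (cases "a \<le> b") auto
      show "(cmod (indicator (\<Union>i<n. D i) x))\<^sup>2 \<le> indicator {a<..b} x"
        "(cmod (indicator (\<Union>i. D i) x))\<^sup>2 \<le> indicator {a<..b} x" for n x
        by (auto simp: indicator_def D_def)
    qed
    then show ?case by (simp add: D_def)
  qed
qed

text \<open>Simple functions converging to \<open>f\<close> with modulus at most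
  \<open>2 * cmod (f x)\<close>, cut off to growing intervals, are finite combinations of indicators
  of bounded Borel sets; \<open>4 * (cmod (f x))^2\<close> dominates their squares.\<close>

lemma schwartz_dense:
  assumes f: "f \<in> L2"
  shows "approximable f"
proof -
  note [measurable] = L2_measurable[OF f]
  obtain F where F: "\<And>i. simple_function borel (F i)" "\<And>x. (\<lambda>i. F i x) \<longlonglongrightarrow> f x" "\<And>i x. cmod (F i x) \<le> 2 * cmod (f x)"
    using borel_measurable_implies_sequence_metric[OF L2_measurable[OF f], of 0]
    unfolding space_borel dist_norm diff_zero by blast
  define J where "J i = {- real i<..real i}" for i
  define s where "s i x = F i x * indicator (J i) x" for i x
  show ?thesis
  proof (rule approximable_dominated)
    show "approximable (s i)" for i
    proof -
      have fin: "finite (range (F i))" using simple_functionD(1)[OF F(1)] by simp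
      have meas: "F i -` {y} \<in> sets borel" for y
        using simple_functionD(2)[OF F(1), of i "{y}"] by simp
      have "s i = (\<lambda>x. \<Sum>y\<in>range (F i). y * indicator (F i -` {y} \<inter> J i) x)"
      proof (rule ext)
        fix x
        have "F i x = (\<Sum>y\<in>range (F i). indicator (F i -` {y}) x *\<^sub>R y)"
          using simple_function_indicator_representation_banach[OF F(1), of x i, unfolded space_borel Int_UNIV_right]
          by blast
        from arg_cong[OF this, of "\<lambda>z. z * indicator (J i) x"]
        have "s i x = (\<Sum>y\<in>range (F i). indicator (F i -` {y}) x *\<^sub>R y) * indicator (J i) x"
          by (simp only: s_def)
        also have "\<dots> = (\<Sum>y\<in>range (F i). y * indicator (F i -` {y} \<inter> J i) x)"
          unfolding sum_distrib_right by (intro sum.cong refl) (auto simp: indicator_def)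
        finally show "s i x = (\<Sum>y\<in>range (F i). y * indicator (F i -` {y} \<inter> J i) x)" .
      qed
      then show ?thesis
        using approximable_sum[OF fin, of "\<lambda>y. indicator (F i -` {y} \<inter> J i)" "\<lambda>y. y"]
          approximable_indicator[OF meas] by (simp add: J_def)
    qed
    show "AE x in lborel. (\<lambda>i. s i x) \<longlonglongrightarrow> f x"
    proof (intro AE_I2)
      fix x :: real
      obtain N where N: "\<bar>x\<bar> < real N" using reals_Archimedean2 by blast
      have "\<forall>\<^sub>F i in sequentially. F i x = s i x"
        using eventually_ge_at_top[of N]
      proof eventually_elim
        case (elim i)
        then have "x \<in> J i" using N by (auto simp: J_def)
        then show ?case by (simp add: s_def)
      qed
      with F(2) show "(\<lambda>i. s i x) \<longlonglongrightarrow> f x" by (rule Lim_transform_eventually)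
    qed
    show "integrable lborel (\<lambda>x. 4 * (cmod (f x))\<^sup>2)"
      using L2_integrable[OF f] by simp
    show "(cmod (s i x))\<^sup>2 \<le> 4 * (cmod (f x))\<^sup>2" for i x
      using power_mono[OF F(3)[of i x] norm_ge_zero, of 2]
      by (simp add: s_def indicator_def power_mult_distrib)
  qed (use L2_measurable[OF f] in auto)
qed

section \<open>Continuity in the parameters\<close>

lemma integral_derivative_eq_0:
  fixes g :: "real \<Rightarrow> complex"
  assumes g: "\<And>x. (g has_vector_derivative g' x) (at x)" and cont: "\<And>x. isCont g' x"
    and int: "integrable lborel g'"
    and top: "(g \<longlongrightarrow> 0) at_top" and bot: "(g \<longlongrightarrow> 0) at_bot"
  shows "(\<integral>x. g' x \<partial>lborel) = 0"
proof -
  have "(LBINT x=-\<infinity>..\<infinity>. g' x) = 0 - 0"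
  proof (rule interval_integral_FTC_integrable[where F=g])
    show "set_integrable lborel (einterval (-\<infinity>) \<infinity>) g'"
      using int by (simp add: set_integrable_def einterval_def)
    show "((g \<circ> real_of_ereal) \<longlongrightarrow> 0) (at_right (-\<infinity>))" "((g \<circ> real_of_ereal) \<longlongrightarrow> 0) (at_left \<infinity>)"
      using top bot by (simp_all add: ereal_tendsto_simps)
  qed (use g cont in auto)
  then show ?thesis
    by (simp add: interval_lebesgue_integral_def set_lebesgue_integral_def einterval_def)
qed

lemma mult_exp_i_tendsto_0:
  assumes "((f :: real \<Rightarrow> complex) \<longlongrightarrow> 0) F"
  shows "((\<lambda>t. f t * exp (\<i> * complex_of_real (h t))) \<longlongrightarrow> 0) F"
  by (rule tendsto_norm_zero_cancel) (simp add: norm_mult tendsto_norm_zero[OF assms])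

text \<open>The derivative of \<open>f t * exp (\<i> * u * t)\<close> has integral 0, because the
  product vanishes at both ends.\<close>

lemma ft_vderiv:
  assumes f: "schwartz f"
  shows "ft (vderiv f) u = - (\<i> * complex_of_real u) * ft f u"
proof -
  define e where "e t = exp (\<i> * complex_of_real (u * t))" for t
  have e: "(e has_vector_derivative \<i> * complex_of_real u * e t) (at t)" for t
    unfolding e_def by (auto intro!: derivative_eq_intros has_vector_derivative_real_field)
  have e_cont: "isCont e t" for t
    using e has_vector_derivative_continuous by blast
  note f' = schwartz_vderiv[OF f]
  have int: "integrable lborel (\<lambda>t. vderiv f t * e t)" "integrable lborel (\<lambda>t. f t * e t)"
    unfolding e_def by (intro integrable_mult_exp_i schwartz_integrable f f'; simp)+
  have "(\<integral>t. f t * (\<i> * complex_of_real u * e t) + vderiv f t * e t \<partial>lborel) = 0"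
  proof (rule integral_derivative_eq_0)
    show "((\<lambda>t. f t * e t) has_vector_derivative f t * (\<i> * complex_of_real u * e t) + vderiv f t * e t) (at t)" for t
      by (intro has_vector_derivative_mult schwartz_has_vector_derivative[OF f] e)
    show "isCont (\<lambda>t. f t * (\<i> * complex_of_real u * e t) + vderiv f t * e t) t" for t
      by (intro continuous_intros schwartz_isCont f f' e_cont)
    have "integrable lborel (\<lambda>t. (\<i> * complex_of_real u) * (f t * e t) + vderiv f t * e t)"
      by (intro Bochner_Integration.integrable_add integrable_mult_right int)
    then show "integrable lborel (\<lambda>t. f t * (\<i> * complex_of_real u * e t) + vderiv f t * e t)"
      by (simp add: mult_ac)
    show "((\<lambda>t. f t * e t) \<longlongrightarrow> 0) at_top" "((\<lambda>t. f t * e t) \<longlongrightarrow> 0) at_bot"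
      unfolding e_def by (intro mult_exp_i_tendsto_0 schwartz_tendsto_0 f)+
  qed
  also have "(\<lambda>t. f t * (\<i> * complex_of_real u * e t) + vderiv f t * e t)
      = (\<lambda>t. (\<i> * complex_of_real u) * (f t * e t) + vderiv f t * e t)"
    by (simp add: mult_ac)
  finally have "(\<i> * complex_of_real u) * ft f u + ft (vderiv f) u = 0"
    using int by (simp add: ft_def e_def)
  then show ?thesis
    by (simp add: add_eq_0_iff)
qed

text \<open>Two derivatives bound \<open>u^2 * cmod (ft f u)\<close>; together with the bound on
  \<open>ft f\<close> itself this gives decay like \<open>1 / (1 + u^2)\<close>.\<close>

lemma integrable_ft_schwartz:
  assumes f: "schwartz f" shows "integrable lborel (ft f)"
proof (rule Bochner_Integration.integrable_bound)
  define C where "C = (\<integral>\<xi>. cmod (f \<xi>) \<partial>lborel) + (\<integral>\<xi>. cmod (vderiv (vderiv f) \<xi>) \<partial>lborel)"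
  show "integrable lborel (\<lambda>u. C * (1 / (1 + u\<^sup>2)))"
    by (intro integrable_mult_right integrable_inverse_1_plus_power2)
  show "ft f \<in> borel_measurable lborel"
    using schwartz_measurable[OF f] by simp
  have "cmod (ft f u) \<le> \<bar>C * (1 / (1 + u\<^sup>2))\<bar>" for u
  proof -
    have "cmod (ft (vderiv (vderiv f)) u) = u\<^sup>2 * cmod (ft f u)"
      by (simp add: ft_vderiv f schwartz_vderiv norm_mult power2_eq_square)
    with cmod_ft_le[of f u] cmod_ft_le[of "vderiv (vderiv f)" u]
    have "(1 + u\<^sup>2) * cmod (ft f u) \<le> C"
      by (simp add: C_def algebra_simps)
    moreover have "0 < 1 + u\<^sup>2" by (simp add: add_pos_nonneg)
    ultimately have "cmod (ft f u) \<le> C * (1 / (1 + u\<^sup>2))"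
      by (simp add: pos_le_divide_eq mult.commute)
    then show ?thesis by linarith
  qed
  then show "AE u in lborel. norm (ft f u) \<le> norm (C * (1 / (1 + u\<^sup>2)))"
    by simp
qed

lemma ft_tendsto:
  assumes \<phi>: "integrable lborel \<phi>" and u: "(u \<longlonglongrightarrow> x)"
  shows "(\<lambda>n. ft \<phi> (u n)) \<longlonglongrightarrow> ft \<phi> x"
  unfolding ft_def
proof (rule integral_dominated_convergence)
  note [measurable] = borel_measurable_integrable[OF \<phi>]
  show "(\<lambda>\<xi>. \<phi> \<xi> * exp (\<i> * complex_of_real (u n * \<xi>))) \<in> borel_measurable lborel"
    "(\<lambda>\<xi>. \<phi> \<xi> * exp (\<i> * complex_of_real (x * \<xi>))) \<in> borel_measurable lborel" for n
    by measurable
  show "integrable lborel (\<lambda>\<xi>. cmod (\<phi> \<xi>))" using \<phi> by simp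
  show "AE \<xi> in lborel. (\<lambda>n. \<phi> \<xi> * exp (\<i> * complex_of_real (u n * \<xi>))) \<longlonglongrightarrow> \<phi> \<xi> * exp (\<i> * complex_of_real (x * \<xi>))"
    by (intro AE_I2 tendsto_intros u)
  show "AE \<xi> in lborel. norm (\<phi> \<xi> * exp (\<i> * complex_of_real (u n * \<xi>))) \<le> cmod (\<phi> \<xi>)" for n
    by (simp add: norm_mult del: of_real_mult)
qed

section \<open>The operators on Schwartz functions and their convergence\<close>

lemma fourier_eq_ft: "fourier f \<xi> = complex_of_real (1 / sqrt (2 * pi)) * ft f (- 1 * \<xi>)"
  by (simp add: fourier_def ft_def mult.commute)

lemma integrable_fourier_schwartz:
  assumes "schwartz f" shows "integrable lborel (fourier f)"
  unfolding fourier_eq_ft[abs_def]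
  using lborel_integrable_real_affine[OF integrable_ft_schwartz[OF assms], of "-1" 0]
  by (intro integrable_mult_right) simp

lemma fourier_L2:
  assumes "integrable lborel f" "f \<in> L2"
  shows "fourier f \<in> L2" "L2sq (fourier f) \<le> L2sq f"
proof -
  have ft: "(\<lambda>\<xi>. ft f (- 1 * \<xi>)) \<in> L2"
    by (intro L2_dilation ft_L2 assms) simp
  then show "fourier f \<in> L2"
    unfolding fourier_eq_ft[abs_def] by (intro L2_cmult)
  have "L2sq (fourier f) = (cmod (complex_of_real (1 / sqrt (2 * pi))))\<^sup>2 * L2sq (ft f)"
    unfolding fourier_eq_ft[abs_def] L2sq_cmult by (subst L2sq_dilation) simp_all
  also have "(cmod (complex_of_real (1 / sqrt (2 * pi))))\<^sup>2 = 1 / (2 * pi)"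
    by (simp add: norm_divide power_divide)
  also have "1 / (2 * pi) * L2sq (ft f) \<le> 1 / (2 * pi) * (2 * pi * L2sq f)"
    by (intro mult_left_mono ft_L2 assms) simp
  finally show "L2sq (fourier f) \<le> L2sq f" by simp
qed

definition chirp :: "real \<Rightarrow> (real \<Rightarrow> complex) \<Rightarrow> real \<Rightarrow> complex" where
  "chirp a f \<xi> = fourier f \<xi> * exp (\<i> * complex_of_real (a * \<xi>\<^sup>2))"

lemma Gpre_eq_ft_chirp: "Gpre a b f u = ft (chirp a f) (b * u)"
  unfolding Gpre_def ft_def chirp_def
  by (intro Bochner_Integration.integral_cong refl) (simp add: algebra_simps flip: exp_add)

lemma cmod_chirp: "cmod (chirp a f \<xi>) = cmod (fourier f \<xi>)"
  by (simp add: chirp_def norm_mult del: of_real_mult of_real_power)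

lemma integrable_chirp: "schwartz f \<Longrightarrow> integrable lborel (chirp a f)"
  unfolding chirp_def by (intro integrable_mult_exp_i integrable_fourier_schwartz) auto

lemma chirp_L2:
  assumes "schwartz f"
  shows "chirp a f \<in> L2" "L2sq (chirp a f) \<le> L2sq f"
proof -
  have "fourier f \<in> L2" "L2sq (fourier f) \<le> L2sq f"
    using assms by (auto intro: fourier_L2 schwartz_integrable schwartz_L2)
  then show "chirp a f \<in> L2" "L2sq (chirp a f) \<le> L2sq f"
    using borel_measurable_integrable[OF integrable_chirp[OF assms]]
    by (auto simp: L2_def L2sq_def cmod_chirp)
qed

lemma Gpre_L2:
  assumes "schwartz f" "b \<noteq> 0"
  shows "Gpre a b f \<in> L2" "L2sq (Gpre a b f) \<le> 2 * pi / \<bar>b\<bar> * L2sq f"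
proof -
  show "Gpre a b f \<in> L2"
    unfolding Gpre_eq_ft_chirp[abs_def] using assms
    by (intro L2_dilation ft_L2 integrable_chirp chirp_L2)
  have "L2sq (ft (chirp a f)) \<le> 2 * pi * L2sq (chirp a f)"
    by (intro ft_L2 integrable_chirp chirp_L2 assms)
  also have "\<dots> \<le> 2 * pi * L2sq f"
    by (intro mult_left_mono chirp_L2 assms) simp
  finally have "L2sq (ft (chirp a f)) / \<bar>b\<bar> \<le> 2 * pi * L2sq f / \<bar>b\<bar>"
    by (intro divide_right_mono) auto
  then show "L2sq (Gpre a b f) \<le> 2 * pi / \<bar>b\<bar> * L2sq f"
    unfolding Gpre_eq_ft_chirp[abs_def] by (simp add: L2sq_dilation assms)
qed

text \<open>The Riesz-Scheffe argument: \<open>2 |s\<^sub>n|\<^sup>2 + 2 |f|\<^sup>2 - |f - s\<^sub>n|\<^sup>2\<close> is nonnegative and tends to \<open>4 |f|\<^sup>2\<close>.\<close>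
lemma L2sq_Scheffe:
  assumes s: "\<And>n. s n \<in> L2" and f: "f \<in> L2"
    and lim: "\<And>x. (\<lambda>n. s n x) \<longlonglongrightarrow> f x" and norms: "(\<lambda>n. L2sq (s n)) \<longlonglongrightarrow> L2sq f"
  shows "(\<lambda>n. L2sq (\<lambda>x. f x - s n x)) \<longlonglongrightarrow> 0"
proof -
  define F where "F n x = 2 * (cmod (s n x))\<^sup>2 + 2 * (cmod (f x))\<^sup>2 - (cmod (f x - s n x))\<^sup>2" for n x
  define g where "g x = 4 * (cmod (f x))\<^sup>2" for x
  have F_int: "integrable lborel (F n)" for n
    unfolding F_def using s[of n] f L2_diff[OF f s[of n]]
    by (intro Bochner_Integration.integrable_diff Bochner_Integration.integrable_add integrable_mult_right L2_integrable)
  have g_int: "integrable lborel g"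
    unfolding g_def using f by (intro integrable_mult_right L2_integrable)
  have F0: "F n x \<ge> 0" for n x
    using cmod_diff_power2_le[of "f x" "s n x"] by (simp add: F_def)
  have F_eq: "(\<integral>x. F n x \<partial>lborel) = 2 * L2sq (s n) + 2 * L2sq f - L2sq (\<lambda>x. f x - s n x)" for n
    unfolding F_def L2sq_def using s[of n] f L2_diff[OF f s[of n]] by (simp add: L2_integrable)
  have g_norm: "norm (g x) = g x" for x
    by (simp add: g_def)
  have g_eq: "(\<integral>x. g x \<partial>lborel) = 4 * L2sq f"
    by (simp add: g_def L2sq_def)
  have "(\<lambda>n. \<integral>\<^sup>+ x. ennreal (norm (F n x - g x)) \<partial>lborel) \<longlonglongrightarrow> 0"
  proof (rule Scheffe_lemma1[OF F_int g_int])
    have "(\<lambda>n. F n x) \<longlonglongrightarrow> 2 * (cmod (f x))\<^sup>2 + 2 * (cmod (f x))\<^sup>2 - (cmod (f x - f x))\<^sup>2" for x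
      unfolding F_def by (intro tendsto_intros lim)
    then show "AE x in lborel. (\<lambda>n. F n x) \<longlonglongrightarrow> g x"
      by (simp add: g_def)
    have "limsup (\<lambda>n. \<integral>\<^sup>+ x. ennreal (norm (F n x)) \<partial>lborel) \<le> limsup (\<lambda>n. ennreal (2 * L2sq (s n) + 2 * L2sq f))"
    proof (intro Limsup_mono always_eventually allI)
      fix n
      have "(\<integral>\<^sup>+ x. ennreal (norm (F n x)) \<partial>lborel) = ennreal (\<integral>x. F n x \<partial>lborel)"
        using F0 F_int by (simp add: nn_integral_eq_integral)
      also have "\<dots> \<le> ennreal (2 * L2sq (s n) + 2 * L2sq f)"
        unfolding F_eq by (intro ennreal_leI) (simp add: L2sq_nonneg)
      finally show "(\<integral>\<^sup>+ x. ennreal (norm (F n x)) \<partial>lborel) \<le> ennreal (2 * L2sq (s n) + 2 * L2sq f)" .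
    qed
    also have "(\<lambda>n. ennreal (2 * L2sq (s n) + 2 * L2sq f)) \<longlonglongrightarrow> ennreal (2 * L2sq f + 2 * L2sq f)"
      by (intro tendsto_ennrealI tendsto_intros norms)
    then have "limsup (\<lambda>n. ennreal (2 * L2sq (s n) + 2 * L2sq f)) = ennreal (4 * L2sq f)"
      by (subst lim_imp_Limsup) auto
    also have "ennreal (4 * L2sq f) = (\<integral>\<^sup>+ x. ennreal (norm (g x)) \<partial>lborel)"
      unfolding g_eq[symmetric] g_norm by (rule nn_integral_eq_integral[symmetric, OF g_int]) (simp add: g_def)
    finally show "limsup (\<lambda>n. \<integral>\<^sup>+ x. ennreal (norm (F n x)) \<partial>lborel) \<le> (\<integral>\<^sup>+ x. ennreal (norm (g x)) \<partial>lborel)" .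
  qed
  also have "(\<lambda>n. \<integral>\<^sup>+ x. ennreal (norm (F n x - g x)) \<partial>lborel) = (\<lambda>n. ennreal (\<integral>x. norm (F n x - g x) \<partial>lborel))"
    using F_int g_int by (intro ext nn_integral_eq_integral) auto
  finally have lim0: "(\<lambda>n. \<integral>x. norm (F n x - g x) \<partial>lborel) \<longlonglongrightarrow> 0"
    by (subst (asm) ennreal_0[symmetric], subst (asm) tendsto_ennreal_iff) auto
  have "(\<lambda>n. \<integral>x. F n x - g x \<partial>lborel) \<longlonglongrightarrow> 0"
    by (rule Lim_null_comparison[OF always_eventually[OF allI[OF integral_norm_bound]] lim0])
  \<comment> \<open>The integral of \<open>F n\<close> contains the wanted quantity with a minus
    sign; the remaining terms converge by \<open>norms\<close>, and the equation is solved for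
    it.\<close>
  then have "(\<lambda>n. 2 * L2sq (s n) - 2 * L2sq f - (\<integral>x. F n x - g x \<partial>lborel)) \<longlonglongrightarrow> 2 * L2sq f - 2 * L2sq f - 0"
    by (intro tendsto_intros norms)
  then show ?thesis
    using F_int g_int by (simp add: F_eq g_eq)
qed

text \<open>Continuity of \<open>\<psi>\<close> gives pointwise convergence, and the norms converge
  because they scale by \<open>1 / \<bar>b n\<bar>\<close>; \<open>L2sq_Scheffe\<close> then takes
  the place of a dominating function.\<close>

lemma dilation_tendsto:
  assumes \<psi>: "\<psi> \<in> L2" and cont: "\<And>u x. u \<longlonglongrightarrow> x \<Longrightarrow> (\<lambda>n. \<psi> (u n)) \<longlonglongrightarrow> \<psi> x"
    and b: "b \<longlonglongrightarrow> b0" "b0 \<noteq> 0" "\<And>n. b n \<noteq> 0"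
  shows "(\<lambda>n. L2sq (\<lambda>u. \<psi> (b0 * u) - \<psi> (b n * u))) \<longlonglongrightarrow> 0"
proof (rule L2sq_Scheffe)
  show "(\<lambda>u. \<psi> (b n * u)) \<in> L2" "(\<lambda>u. \<psi> (b0 * u)) \<in> L2" for n
    by (intro L2_dilation \<psi> b)+
  show "(\<lambda>n. \<psi> (b n * u)) \<longlonglongrightarrow> \<psi> (b0 * u)" for u
    by (intro cont tendsto_intros b)
  have "(\<lambda>n. L2sq \<psi> / \<bar>b n\<bar>) \<longlonglongrightarrow> L2sq \<psi> / \<bar>b0\<bar>"
    using b(2) by (intro tendsto_intros b(1)) simp
  then show "(\<lambda>n. L2sq (\<lambda>u. \<psi> (b n * u))) \<longlonglongrightarrow> L2sq (\<lambda>u. \<psi> (b0 * u))"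
    using b by (simp add: L2sq_dilation)
qed

lemma chirp_tendsto:
  assumes f: "schwartz f" and a: "a \<longlonglongrightarrow> a0"
  shows "(\<lambda>n. L2sq (\<lambda>\<xi>. chirp a0 f \<xi> - chirp (a n) f \<xi>)) \<longlonglongrightarrow> 0"
proof (rule L2sq_dominated_convergence)
  show "chirp (a n) f \<in> borel_measurable borel" "chirp a0 f \<in> borel_measurable borel" for n
    using integrable_chirp[OF f] by (auto dest: borel_measurable_integrable)
  show "integrable lborel (\<lambda>\<xi>. (cmod (fourier f \<xi>))\<^sup>2)"
    by (intro L2_integrable fourier_L2 schwartz_integrable schwartz_L2 f)
  show "AE \<xi> in lborel. (\<lambda>n. chirp (a n) f \<xi>) \<longlonglongrightarrow> chirp a0 f \<xi>"
    unfolding chirp_def by (intro AE_I2 tendsto_intros a)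
qed (auto simp: cmod_chirp)

text \<open>The parameters are moved one at a time. At the common dilation \<open>b n\<close> the
  difference is the transform of a difference of chirps, small by \<open>ft_L2\<close> and
  \<open>chirp_tendsto\<close>; at the common \<open>a0\<close> only a dilation varies.\<close>

lemma Gpre_tendsto:
  assumes f: "schwartz f" and a: "a \<longlonglongrightarrow> a0" and b: "b \<longlonglongrightarrow> b0" "b0 \<noteq> 0" "\<And>n. b n \<noteq> 0"
  shows "(\<lambda>n. L2sq (\<lambda>u. Gpre (a n) (b n) f u - Gpre a0 b0 f u)) \<longlonglongrightarrow> 0"
proof -
  let ?\<psi> = "ft (chirp a0 f)"
  let ?D = "\<lambda>n. 2 * (2 * pi / \<bar>b n\<bar> * L2sq (\<lambda>\<xi>. chirp a0 f \<xi> - chirp (a n) f \<xi>)) +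
      2 * L2sq (\<lambda>u. ?\<psi> (b0 * u) - ?\<psi> (b n * u))"
  have \<psi>: "?\<psi> \<in> L2"
    by (intro ft_L2 integrable_chirp chirp_L2 f)
  have "(\<lambda>n. L2sq (\<lambda>u. ?\<psi> (b0 * u) - ?\<psi> (b n * u))) \<longlonglongrightarrow> 0"
    by (rule dilation_tendsto[OF \<psi> ft_tendsto[OF integrable_chirp[OF f]] b])
  moreover have "(\<lambda>n. 2 * pi / \<bar>b n\<bar>) \<longlonglongrightarrow> 2 * pi / \<bar>b0\<bar>"
    using b(2) by (intro tendsto_intros b(1)) simp
  ultimately have "?D \<longlonglongrightarrow> 2 * (2 * pi / \<bar>b0\<bar> * 0) + 2 * 0"
    using chirp_tendsto[OF f a] by (intro tendsto_add tendsto_mult tendsto_const)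
  then have D: "?D \<longlonglongrightarrow> 0" by simp
  have le: "norm (L2sq (\<lambda>u. Gpre (a n) (b n) f u - Gpre a0 b0 f u)) \<le> ?D n" for n
  proof -
    have "L2sq (\<lambda>u. Gpre (a n) (b n) f u - Gpre a0 b0 f u) \<le>
      2 * L2sq (\<lambda>u. Gpre (a n) (b n) f u - Gpre a0 (b n) f u) + 2 * L2sq (\<lambda>u. Gpre a0 (b n) f u - Gpre a0 b0 f u)"
      by (intro L2sq_diff_triangle Gpre_L2 f b)
    also have "L2sq (\<lambda>u. Gpre (a n) (b n) f u - Gpre a0 (b n) f u) \<le>
      2 * pi / \<bar>b n\<bar> * L2sq (\<lambda>\<xi>. chirp a0 f \<xi> - chirp (a n) f \<xi>)"
    proof -
      let ?d = "\<lambda>\<xi>. chirp (a n) f \<xi> - chirp a0 f \<xi>"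
      have d: "integrable lborel ?d" "?d \<in> L2"
        by (intro Bochner_Integration.integrable_diff L2_diff integrable_chirp chirp_L2 f)+
      have "Gpre (a n) (b n) f u - Gpre a0 (b n) f u = ft ?d (b n * u)" for u
        unfolding Gpre_eq_ft_chirp ft_def
        by (subst Bochner_Integration.integral_diff[symmetric])
           (auto intro!: integrable_mult_exp_i integrable_chirp f simp: algebra_simps simp del: of_real_mult)
      then have "L2sq (\<lambda>u. Gpre (a n) (b n) f u - Gpre a0 (b n) f u) = L2sq (ft ?d) / \<bar>b n\<bar>"
        by (simp add: L2sq_dilation b)
      also have "\<dots> \<le> 2 * pi * L2sq ?d / \<bar>b n\<bar>"
        by (intro divide_right_mono ft_L2 d) simp
      finally show ?thesis by (simp add: L2sq_diff_commute[of "chirp a0 f"])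
    qed
    also have "L2sq (\<lambda>u. Gpre a0 (b n) f u - Gpre a0 b0 f u) = L2sq (\<lambda>u. ft (chirp a0 f) (b0 * u) - ft (chirp a0 f) (b n * u))"
      unfolding Gpre_eq_ft_chirp by (rule L2sq_diff_commute)
    finally show ?thesis by (simp add: L2sq_nonneg)
  qed
  show ?thesis
    by (rule Lim_null_comparison[OF always_eventually[OF allI[OF le]] D])
qed

section \<open>Extension from Schwartz functions to all of L2\<close>

lemma is_G_operator_L2: "is_G_operator T a b \<Longrightarrow> f \<in> L2 \<Longrightarrow> T f \<in> L2"
  by (simp add: is_G_operator_def)

lemma is_G_operator_schwartz:
  assumes "is_G_operator T a b" "schwartz f"
  shows "AE u in lborel. T f u = Gpre a b f u"
  using assms by (simp add: is_G_operator_def)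

lemma is_G_operator_diff:
  assumes T: "is_G_operator T a b" and f: "f \<in> L2" and g: "g \<in> L2"
  shows "L2sq (\<lambda>u. T f u - T g u) = L2sq (T (\<lambda>y. f y - g y))"
proof (rule L2sq_cong_AE)
  have "AE x in lborel. T (\<lambda>y. f y + (-1) * g y) x = T f x + (-1) * T g x"
    using T f g unfolding is_G_operator_def by blast
  then show "AE x in lborel. T f x - T g x = T (\<lambda>y. f y - g y) x"
    by (auto elim: eventually_mono)
  show "(\<lambda>u. T f u - T g u) \<in> borel_measurable borel" "T (\<lambda>y. f y - g y) \<in> borel_measurable borel"
    by (intro L2_measurable L2_diff is_G_operator_L2[OF T] f g)+
qed

text \<open>The constant is not sharp: it only matters that it is locally bounded in \<open>b\<close>.\<close>
lemma is_G_operator_bound: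
  assumes T: "is_G_operator T a b" and b: "b \<noteq> 0" and f: "f \<in> L2"
  shows "L2sq (T f) \<le> 8 * pi / \<bar>b\<bar> * L2sq f"
proof (rule field_le_epsilon)
  fix e :: real assume e: "e > 0"
  \<comment> \<open>\<open>C\<close> may depend on the operator in an uncontrolled way. It
    multiplies only the approximation error, so it disappears from the final bound.\<close>
  obtain C where C: "\<And>f. f \<in> L2 \<Longrightarrow> L2norm (T f) \<le> C * L2norm f"
    using T unfolding is_G_operator_def by blast
  have C2: "L2sq (T f) \<le> C\<^sup>2 * L2sq f" if "f \<in> L2" for f
    using power_mono[OF C[OF that], of 2] by (simp add: power_mult_distrib L2norm_power2 L2norm_eq_sqrt L2sq_nonneg)
  \<comment> \<open>\<open>M - 1\<close> collects the coefficients of the error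
    \<open>L2sq (\<lambda>x. f x - g x)\<close> below; the summand 1 makes \<open>M\<close>
    positive.\<close>
  define M where "M = 8 * pi / \<bar>b\<bar> + 2 * C\<^sup>2 + 1"
  have M: "M > 0" by (simp add: M_def add_nonneg_pos)
  obtain g where g: "schwartz g" "L2sq (\<lambda>x. f x - g x) < e / M"
    using schwartz_dense[OF f] e M unfolding approximable_def by (meson divide_pos_pos)
  note g2 = schwartz_L2[OF g(1)]
  have Tg: "L2sq (T g) \<le> 2 * pi / \<bar>b\<bar> * L2sq g"
  proof -
    have "L2sq (T g) = L2sq (Gpre a b g)"
      using T g b by (intro L2sq_cong_AE is_G_operator_schwartz L2_measurable is_G_operator_L2[OF T] g2 Gpre_L2)
    then show ?thesis using Gpre_L2(2)[OF g(1) b] by simp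
  qed
  have "L2sq (T f) \<le> 2 * L2sq (\<lambda>u. T f u - T g u) + 2 * L2sq (T g)"
    using L2sq_add_le[OF L2_diff[OF is_G_operator_L2[OF T f] is_G_operator_L2[OF T g2]] is_G_operator_L2[OF T g2]] by simp
  also have "L2sq (\<lambda>u. T f u - T g u) \<le> C\<^sup>2 * L2sq (\<lambda>x. f x - g x)"
    unfolding is_G_operator_diff[OF T f g2] by (intro C2 L2_diff f g2)
  also note Tg
  also have "L2sq g \<le> 2 * L2sq (\<lambda>x. f x - g x) + 2 * L2sq f"
    using L2sq_add_le[OF L2_diff[OF g2 f] f] by (simp add: L2sq_diff_commute[of g])
  finally have "L2sq (T f) \<le> 2 * (C\<^sup>2 * L2sq (\<lambda>x. f x - g x)) + 2 * (2 * pi / \<bar>b\<bar> * (2 * L2sq (\<lambda>x. f x - g x) + 2 * L2sq f))"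
    by (simp add: mult_left_mono divide_right_mono)
  also have "\<dots> = 8 * pi / \<bar>b\<bar> * L2sq f + (M - 1) * L2sq (\<lambda>x. f x - g x)"
    by (simp add: M_def algebra_simps)
  also have "(M - 1) * L2sq (\<lambda>x. f x - g x) \<le> M * L2sq (\<lambda>x. f x - g x)"
    by (intro mult_right_mono L2sq_nonneg) simp
  also have "\<dots> \<le> e"
    using g(2) M by (simp add: pos_less_divide_eq mult.commute less_imp_le)
  finally show "L2sq (T f) \<le> 8 * pi / \<bar>b\<bar> * L2sq f + e" by simp
qed

text \<open>Approximate \<open>f\<close> by a Schwartz function \<open>g\<close>: the two errors
  from replacing \<open>f\<close> by \<open>g\<close> are small uniformly in large \<open>n\<close>,
  and the middle term converges by \<open>Gpre_tendsto\<close>.\<close>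

lemma is_G_operator_tendsto:
  assumes T: "\<And>n. is_G_operator (T n) (a n) (b n)" and T0: "is_G_operator T0 a0 b0"
    and a: "a \<longlonglongrightarrow> a0" and b: "b \<longlonglongrightarrow> b0" "b0 \<noteq> 0" "\<And>n. b n \<noteq> 0" and f: "f \<in> L2"
  shows "(\<lambda>n. L2sq (\<lambda>u. T n f u - T0 f u)) \<longlonglongrightarrow> 0"
proof (rule LIMSEQ_I)
  fix e :: real assume e: "e > 0"
  \<comment> \<open>The bound of \<open>is_G_operator_bound\<close> at \<open>b0\<close>, enlarged
    by 1 so that it also holds at \<open>b n\<close> for large \<open>n\<close>.\<close>
  define K where "K = 8 * pi / \<bar>b0\<bar> + 1"
  have K: "K > 0" by (simp add: K_def add_nonneg_pos)
  have "0 < e / (12 * K)" using e K by simp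
  then obtain g where g: "schwartz g" "L2sq (\<lambda>x. f x - g x) < e / (12 * K)"
    using schwartz_dense[OF f] unfolding approximable_def by blast
  note g2 = schwartz_L2[OF g(1)]
  have "(\<lambda>n. 8 * pi / \<bar>b n\<bar>) \<longlonglongrightarrow> 8 * pi / \<bar>b0\<bar>"
    using b(2) by (intro tendsto_intros b(1)) simp
  from order_tendstoD(2)[OF this, of K] have ev1: "\<forall>\<^sub>F n in sequentially. 8 * pi / \<bar>b n\<bar> < K"
    by (simp add: K_def)
  have ev2: "\<forall>\<^sub>F n in sequentially. L2sq (\<lambda>u. Gpre (a n) (b n) g u - Gpre a0 b0 g u) < e / 8"
    using e by (intro order_tendstoD(2)[OF Gpre_tendsto[OF g(1) a b]]) simp
  have "\<forall>\<^sub>F n in sequentially. L2sq (\<lambda>u. T n f u - T0 f u) < e"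
    using ev1 ev2
  proof eventually_elim
    case (elim n)
    have bound: "L2sq (\<lambda>u. S f u - S g u) \<le> e / 12" if S: "is_G_operator S a' b'" "b' \<noteq> 0" "8 * pi / \<bar>b'\<bar> < K" for S a' b'
    proof -
      have "L2sq (\<lambda>u. S f u - S g u) \<le> 8 * pi / \<bar>b'\<bar> * L2sq (\<lambda>x. f x - g x)"
        unfolding is_G_operator_diff[OF S(1) f g2] by (intro is_G_operator_bound[OF S(1,2)] L2_diff f g2)
      also have "\<dots> \<le> K * L2sq (\<lambda>x. f x - g x)"
        using S(3) by (intro mult_right_mono L2sq_nonneg) simp
      also have "\<dots> \<le> K * (e / (12 * K))"
        using g(2) K by (intro mult_left_mono) auto
      finally show ?thesis using K by simp
    qed
    note Tf = is_G_operator_L2[OF T f, of n] and Tg = is_G_operator_L2[OF T g2, of n]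
      and T0f = is_G_operator_L2[OF T0 f] and T0g = is_G_operator_L2[OF T0 g2]
    have "L2sq (\<lambda>u. T n f u - T0 f u) \<le> 2 * L2sq (\<lambda>u. T n f u - T n g u) + 2 * L2sq (\<lambda>u. T n g u - T0 f u)"
      by (rule L2sq_diff_triangle[OF Tf Tg T0f])
    moreover have "L2sq (\<lambda>u. T n g u - T0 f u) \<le> 2 * L2sq (\<lambda>u. T n g u - T0 g u) + 2 * L2sq (\<lambda>u. T0 g u - T0 f u)"
      by (rule L2sq_diff_triangle[OF Tg T0g T0f])
    moreover have "L2sq (\<lambda>u. T n f u - T n g u) \<le> e / 12"
      by (rule bound[OF T b(3) elim(1)])
    moreover have "L2sq (\<lambda>u. T0 g u - T0 f u) \<le> e / 12"
      unfolding L2sq_diff_commute[of "T0 g"] by (rule bound[OF T0 b(2)]) (simp add: K_def)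
    moreover have "L2sq (\<lambda>u. T n g u - T0 g u) = L2sq (\<lambda>u. Gpre (a n) (b n) g u - Gpre a0 b0 g u)"
    proof (rule L2sq_cong_AE)
      show "(\<lambda>u. T n g u - T0 g u) \<in> borel_measurable borel"
        by (intro L2_measurable L2_diff Tg T0g)
      show "(\<lambda>u. Gpre (a n) (b n) g u - Gpre a0 b0 g u) \<in> borel_measurable borel"
        by (intro L2_measurable L2_diff Gpre_L2 g b)
      show "AE u in lborel. T n g u - T0 g u = Gpre (a n) (b n) g u - Gpre a0 b0 g u"
        using is_G_operator_schwartz[OF T g(1), of n] is_G_operator_schwartz[OF T0 g(1)]
        by eventually_elim simp
    qed
    \<comment> \<open>The constants add up to
      \<open>2 * (e / 12) + 2 * (2 * (e / 8) + 2 * (e / 12)) = e\<close>, and the middle estimate is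
      strict.\<close>
    ultimately show ?case using elim(2) by linarith
  qed
  then show "\<exists>N. \<forall>n\<ge>N. norm (L2sq (\<lambda>u. T n f u - T0 f u) - 0) < e"
    by (simp add: eventually_sequentially L2sq_nonneg)
qed

section \<open>Complex Gaussian integrals\<close>

definition cgauss :: "complex \<Rightarrow> real \<Rightarrow> complex" where
  "cgauss z x = exp (- (z * complex_of_real (x\<^sup>2)))"

lemma cgauss_measurable [measurable]: "cgauss z \<in> borel_measurable borel"
  unfolding cgauss_def by measurable

lemma cmod_cgauss: "cmod (cgauss z x) = exp (- (Re z * x\<^sup>2))"
  by (simp add: cgauss_def flip: of_real_power)

lemma cgauss_isCont: "isCont (cgauss z) x"
  unfolding cgauss_def by (intro continuous_intros)

lemma schwartz_poly_gauss:
  assumes "c > 0" shows "schwartz (pexp p [:0, 0, c:])"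
  by (rule schwartz_pexp[OF assms, of 0]) (simp add: power2_eq_square algebra_simps)

text \<open>Only \<open>Re z\<close> affects the modulus, so integrability and decay carry over from
  the real Gaussians, which are Schwartz.\<close>

lemma cmod_poly_cgauss:
  "cmod (complex_of_real (poly p x) * cgauss z x) = cmod (pexp p [:0, 0, Re z:] x)"
proof -
  have "poly [:0, 0, Re z:] x = Re z * x\<^sup>2" by (simp add: power2_eq_square)
  then show ?thesis
    by (simp only: norm_mult cmod_cgauss norm_of_real pexp_def abs_mult abs_exp_cancel)
qed

lemma integrable_poly_cgauss:
  assumes "Re z > 0"
  shows "integrable lborel (\<lambda>x. complex_of_real (poly p x) * cgauss z x)"
proof (rule Bochner_Integration.integrable_bound[OF schwartz_integrable[OF schwartz_poly_gauss[OF assms, of p]]])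
  have [measurable]: "poly p \<in> borel_measurable borel"
    by (intro borel_measurable_continuous_onI continuous_intros)
  show "(\<lambda>x. complex_of_real (poly p x) * cgauss z x) \<in> borel_measurable lborel"
    by measurable
qed (simp add: cmod_poly_cgauss)

lemma poly_cgauss_tendsto_0:
  assumes "Re z > 0"
  shows "((\<lambda>x. complex_of_real (poly p x) * cgauss z x) \<longlongrightarrow> 0) at_top"
    and "((\<lambda>x. complex_of_real (poly p x) * cgauss z x) \<longlongrightarrow> 0) at_bot"
proof -
  note lim = schwartz_tendsto_0[OF schwartz_poly_gauss[OF assms], THEN tendsto_norm_zero, of p]
  show "((\<lambda>x. complex_of_real (poly p x) * cgauss z x) \<longlongrightarrow> 0) at_top"
    by (rule tendsto_norm_zero_cancel) (simp only: cmod_poly_cgauss lim)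
  show "((\<lambda>x. complex_of_real (poly p x) * cgauss z x) \<longlongrightarrow> 0) at_bot"
    by (rule tendsto_norm_zero_cancel) (simp only: cmod_poly_cgauss lim)
qed

lemma integrable_cgauss: "Re z > 0 \<Longrightarrow> integrable lborel (cgauss z)"
  using integrable_poly_cgauss[of z 1] by simp

lemma cgauss_has_vector_derivative:
  "(cgauss z has_vector_derivative - 2 * z * complex_of_real x * cgauss z x) (at x)"
  unfolding cgauss_def of_real_power
  by (auto intro!: derivative_eq_intros has_vector_derivative_real_field)

text \<open>The derivative of \<open>x * cgauss z x\<close> has integral 0.\<close>

lemma integral_power2_cgauss:
  assumes z: "Re z > 0"
  shows "(\<integral>x. complex_of_real (x\<^sup>2) * cgauss z x \<partial>lborel) = (\<integral>x. cgauss z x \<partial>lborel) / (2 * z)"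
proof -
  let ?g' = "\<lambda>x. complex_of_real x * (- 2 * z * complex_of_real x * cgauss z x) + 1 * cgauss z x"
  have g'_eq: "?g' = (\<lambda>x. cgauss z x - (2 * z) * (complex_of_real (x\<^sup>2) * cgauss z x))"
    by (simp add: fun_eq_iff power2_eq_square)
  have int: "integrable lborel (\<lambda>x. complex_of_real (x\<^sup>2) * cgauss z x)"
    using integrable_poly_cgauss[OF z, of "[:0, 0, 1:]"] by (simp add: power2_eq_square)
  have "(\<integral>x. ?g' x \<partial>lborel) = 0"
  proof (rule integral_derivative_eq_0)
    show "((\<lambda>x. complex_of_real x * cgauss z x) has_vector_derivative ?g' x) (at x)" for x
      by (intro has_vector_derivative_mult cgauss_has_vector_derivative)
         (auto intro!: derivative_eq_intros has_vector_derivative_real_field)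
    show "isCont ?g' x" for x
      by (intro continuous_intros cgauss_isCont)
    show "integrable lborel ?g'"
      unfolding g'_eq
      by (intro Bochner_Integration.integrable_diff integrable_mult_right integrable_cgauss int z)
    show "((\<lambda>x. complex_of_real x * cgauss z x) \<longlongrightarrow> 0) at_top" "((\<lambda>x. complex_of_real x * cgauss z x) \<longlongrightarrow> 0) at_bot"
      using poly_cgauss_tendsto_0[OF z, of "[:0, 1:]"] by simp_all
  qed
  then have "(\<integral>x. cgauss z x \<partial>lborel) = (2 * z) * (\<integral>x. complex_of_real (x\<^sup>2) * cgauss z x \<partial>lborel)"
    unfolding g'_eq using int integrable_cgauss[OF z] by simp
  moreover have "z \<noteq> 0" using z by auto
  ultimately show ?thesis by simp
qed

text \<open>On the positive half-line \<open>- cgauss w x / (2 * w)\<close> is an antiderivative and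
  yields \<open>1 / (2 * w)\<close>; evenness doubles it.\<close>

lemma has_bochner_integral_abs_cgauss:
  assumes w: "Re w > 0"
  shows "has_bochner_integral lborel (\<lambda>x. complex_of_real \<bar>x\<bar> * cgauss w x) (1 / w)"
proof -
  have w0: "w \<noteq> 0" using w by auto
  let ?f = "\<lambda>x. complex_of_real x * cgauss w x"
  have int: "integrable lborel ?f"
    using integrable_poly_cgauss[OF w, of "[:0, 1:]"] by simp
  have "(LBINT x=0..\<infinity>. ?f x) = 0 - (- (1 / (2 * w)))"
  proof (rule interval_integral_FTC_integrable)
    show "((\<lambda>x. - (cgauss w x / (2 * w))) has_vector_derivative ?f x) (at x)" for x
      using has_vector_derivative_mult_right[OF cgauss_has_vector_derivative[of w x], where a="- 1 / (2 * w)"] w0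
      by simp
    show "isCont ?f x" for x
      by (intro continuous_intros cgauss_isCont)
    show "set_integrable lborel (einterval 0 \<infinity>) ?f"
      unfolding set_integrable_def by (intro integrable_mult_indicator int) simp
    have "(cgauss w \<longlongrightarrow> cgauss w 0) (at_right 0)"
      using cgauss_isCont[of 0 w] unfolding isCont_def filterlim_at_split by blast
    then have "((\<lambda>x. - (cgauss w x / (2 * w))) \<longlongrightarrow> - (cgauss w 0 / (2 * w))) (at_right 0)"
      using w0 by (intro tendsto_intros) auto
    then show "(((\<lambda>x. - (cgauss w x / (2 * w))) \<circ> real_of_ereal) \<longlongrightarrow> - (1 / (2 * w))) (at_right 0)"
      by (simp add: zero_ereal_def ereal_tendsto_simps cgauss_def)
    have "((\<lambda>x. - (cgauss w x / (2 * w))) \<longlongrightarrow> - (0 / (2 * w))) at_top"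
      using poly_cgauss_tendsto_0(1)[OF w, of 1] w0 by (intro tendsto_intros) auto
    then show "(((\<lambda>x. - (cgauss w x / (2 * w))) \<circ> real_of_ereal) \<longlongrightarrow> 0) (at_left \<infinity>)"
      by (simp add: ereal_tendsto_simps)
  qed simp
  then have "(\<integral>x. indicator {0<..} x *\<^sub>R ?f x \<partial>lborel) = 1 / (2 * w)"
    by (simp add: interval_lebesgue_integral_def set_lebesgue_integral_def einterval_def greaterThan_def)
  \<comment> \<open>The open and the closed half-line give the same function, since the integrand
    vanishes at 0.\<close>
  moreover have "(\<lambda>x. indicator {0<..} x *\<^sub>R ?f x) = (\<lambda>x. indicator {0..} x *\<^sub>R (complex_of_real \<bar>x\<bar> * cgauss w x))"
    by (auto simp: fun_eq_iff indicator_def)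
  moreover have "integrable lborel (\<lambda>x. indicator {0<..} x *\<^sub>R ?f x)"
    by (intro integrable_mult_indicator int) simp
  ultimately have "has_bochner_integral lborel (\<lambda>x. indicator {0..} x *\<^sub>R (complex_of_real \<bar>x\<bar> * cgauss w x)) (1 / (2 * w))"
    by (simp add: has_bochner_integral_iff)
  from has_bochner_integral_even_function[OF this]
  have "has_bochner_integral lborel (\<lambda>x. complex_of_real \<bar>x\<bar> * cgauss w x) (2 *\<^sub>R (1 / (2 * w)))"
    by (simp add: cgauss_def)
  also have "2 *\<^sub>R (1 / (2 * w)) = 1 / w"
    by (simp add: scaleR_conv_of_real)
  finally show ?thesis .
qed

text \<open>Laplace's substitution \<open>y = x s\<close> in the double integral of \<open>exp (- z (x\<^sup>2 + y\<^sup>2))\<close>.\<close>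
lemma integral_cgauss_power2:
  assumes z: "Re z > 0"
  shows "(\<integral>x. cgauss z x \<partial>lborel)\<^sup>2 = complex_of_real pi / z"
proof -
  have z0: "z \<noteq> 0" using z by auto
  define w where "w s = z * complex_of_real (1 + s\<^sup>2)" for s
  \<comment> \<open>The double integrand after the substitution \<open>y = x * s\<close>, with
    Jacobian \<open>\<bar>x\<bar>\<close> and \<open>x^2 + y^2 = x^2 * (1 + s^2)\<close>.\<close>
  define k where "k s x = complex_of_real \<bar>x\<bar> * cgauss (w s) x" for s x
  have pos: "0 < 1 + s\<^sup>2" for s :: real by (simp add: add_pos_nonneg)
  have w: "Re (w s) > 0" for s
    using z pos[of s] by (simp add: w_def)
  have k_int: "has_bochner_integral lborel (k s) (1 / w s)" for s
    unfolding k_def by (rule has_bochner_integral_abs_cgauss[OF w])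
  \<comment> \<open>The modulus is the same kernel with a real parameter, so its integral follows
    from the same formula.\<close>
  have k_norm: "norm (k s x) = Re (complex_of_real \<bar>x\<bar> * cgauss (complex_of_real (Re (w s))) x)" for s x
  proof -
    have "cgauss (complex_of_real c) x = complex_of_real (exp (- (c * x\<^sup>2)))" for c
      by (simp add: cgauss_def flip: exp_of_real)
    then show ?thesis
      by (simp add: k_def norm_mult cmod_cgauss)
  qed
  have k_norm_int: "(\<integral>x. norm (k s x) \<partial>lborel) = 1 / Re z * (1 / (1 + s\<^sup>2))" for s
  proof -
    have "has_bochner_integral lborel (\<lambda>x. Re (complex_of_real \<bar>x\<bar> * cgauss (complex_of_real (Re (w s))) x)) (Re (1 / complex_of_real (Re (w s))))"
      using w[of s] by (intro has_bochner_integral_Re has_bochner_integral_abs_cgauss) simp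
    then have "(\<integral>x. norm (k s x) \<partial>lborel) = Re (1 / complex_of_real (Re (w s)))"
      unfolding k_norm by (rule has_bochner_integral_integral_eq)
    also have "\<dots> = 1 / Re (w s)"
      by (metis Re_complex_of_real of_real_1 of_real_divide)
    finally show ?thesis by (simp add: w_def)
  qed
  have meas: "(\<lambda>p. k (fst p) (snd p)) \<in> borel_measurable (lborel \<Otimes>\<^sub>M lborel)"
    unfolding k_def cgauss_def w_def by measurable
  have int: "integrable (lborel \<Otimes>\<^sub>M lborel) (case_prod k)"
  proof (rule lborel_pair.Fubini_integrable)
    show "case_prod k \<in> borel_measurable (lborel \<Otimes>\<^sub>M lborel)"
      using meas by (simp add: split_beta')
    show "integrable lborel (\<lambda>s. \<integral>x. norm (case (s, x) of (s, x) \<Rightarrow> k s x) \<partial>lborel)"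
      by (simp only: prod.case k_norm_int) (intro integrable_mult_right integrable_inverse_1_plus_power2)
    show "AE s in lborel. integrable lborel (\<lambda>x. case (s, x) of (s, x) \<Rightarrow> k s x)"
      using k_int by (auto simp: has_bochner_integral_iff)
  qed
  \<comment> \<open>The substitution degenerates at \<open>x = 0\<close>, which is a null
    set.\<close>
  have inner: "(\<integral>s. k s x \<partial>lborel) = cgauss z x * (\<integral>y. cgauss z y \<partial>lborel)" if "x \<noteq> 0" for x
  proof -
    have "(\<integral>y. cgauss z y \<partial>lborel) = \<bar>x\<bar> *\<^sub>R (\<integral>s. cgauss z (0 + x * s) \<partial>lborel)"
      by (rule lborel_integral_real_affine[OF that])
    then have "cgauss z x * (\<integral>y. cgauss z y \<partial>lborel) = (\<integral>s. cgauss z x * (complex_of_real \<bar>x\<bar> * cgauss z (x * s)) \<partial>lborel)"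
      by (simp add: scaleR_conv_of_real)
    also have "\<dots> = (\<integral>s. k s x \<partial>lborel)"
      by (intro Bochner_Integration.integral_cong refl)
         (simp add: k_def cgauss_def w_def algebra_simps flip: exp_add)
    finally show ?thesis by simp
  qed
  have "(\<integral>x. cgauss z x \<partial>lborel)\<^sup>2 = (\<integral>x. cgauss z x * (\<integral>y. cgauss z y \<partial>lborel) \<partial>lborel)"
    by (simp add: power2_eq_square)
  also have "\<dots> = (\<integral>x. (\<integral>s. k s x \<partial>lborel) \<partial>lborel)"
  proof (rule integral_cong_AE)
    show "(\<lambda>x. \<integral>s. k s x \<partial>lborel) \<in> borel_measurable lborel"
      using meas unfolding k_def cgauss_def w_def by measurable
    have "AE x in lborel. x \<noteq> (0::real)" by (rule AE_lborel_singleton)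
    then show "AE x in lborel. cgauss z x * (\<integral>y. cgauss z y \<partial>lborel) = (\<integral>s. k s x \<partial>lborel)"
      by eventually_elim (simp add: inner)
  qed measurable
  also have "\<dots> = (\<integral>s. (\<integral>x. k s x \<partial>lborel) \<partial>lborel)"
    by (rule lborel_pair.Fubini_integral[OF int])
  also have "\<dots> = (\<integral>s. (1 / z) * complex_of_real (1 / (1 + s\<^sup>2)) \<partial>lborel)"
    using k_int by (simp add: has_bochner_integral_iff w_def)
  also have "\<dots> = (1 / z) * complex_of_real (\<integral>s. 1 / (1 + s\<^sup>2) \<partial>lborel)"
    by (simp only: integral_mult_right_zero integral_complex_of_real)
  also have "integral\<^sup>L lborel (\<lambda>s::real. 1 / (1 + s\<^sup>2)) = pi"
    using LBINT_inverse_1_plus_square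
    by (simp add: interval_lebesgue_integral_def set_lebesgue_integral_def einterval_def divide_inverse)
  finally show ?thesis by simp
qed

section \<open>Testing against Gaussians\<close>

text \<open>With \<open>hermite1\<close>, the first two Hermite functions up to constants. Being
  eigenfunctions of \<open>ft\<close>, they make the pairings Gaussian integrals: the even one sees
  only \<open>b^2\<close>, the odd one brings in a factor \<open>b\<close>.\<close>

definition hermite0 :: "real \<Rightarrow> complex" where "hermite0 = pexp 1 [:0, 0, 1 / 2:]"

definition hermite1 :: "real \<Rightarrow> complex" where "hermite1 = pexp [:0, 1:] [:0, 0, 1 / 2:]"

lemma schwartz_hermite: "schwartz hermite0" "schwartz hermite1"
  unfolding hermite0_def hermite1_def by (intro schwartz_poly_gauss; simp)+

lemma ft_hermite0: "ft hermite0 u = complex_of_real (sqrt (2 * pi) * exp (- u\<^sup>2 / 2))"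
proof -
  have eq: "hermite0 = gauss 1"
    by (simp add: fun_eq_iff hermite0_def pexp_def gauss_def power2_eq_square)
  show ?thesis unfolding eq by (subst ft_gauss) simp_all
qed

text \<open>\<open>hermite1\<close> is minus the derivative of \<open>hermite0\<close>.\<close>

lemma ft_hermite1: "ft hermite1 u = \<i> * complex_of_real u * ft hermite0 u"
proof -
  have "vderiv hermite0 = (\<lambda>x. - hermite1 x)"
    unfolding hermite0_def hermite1_def vderiv_pexp by (simp add: fun_eq_iff pexp_def pderiv_pCons)
  then have "ft (vderiv hermite0) u = - ft hermite1 u"
    by (simp add: ft_def)
  then show ?thesis
    using ft_vderiv[OF schwartz_hermite(1), of u] by simp
qed

lemma integral_Gpre_mult:
  assumes "schwartz f" "integrable lborel \<phi>"
  shows "(\<integral>u. Gpre a b f u * \<phi> u \<partial>lborel) = (\<integral>\<xi>. chirp a f \<xi> * ft \<phi> (b * \<xi>) \<partial>lborel)"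
  unfolding Gpre_eq_ft_chirp by (rule ft_multiplication_formula[OF integrable_chirp[OF assms(1)] assms(2)])

text \<open>The parameter \<open>z\<close> for which pairing \<open>Gpre a b h\<close> with \<open>h t = exp (- t\<^sup>2 / 2)\<close> produces \<open>\<integral> exp (- z \<xi>\<^sup>2) d\<xi>\<close>.\<close>
definition zpar :: "real \<Rightarrow> real \<Rightarrow> complex" where
  "zpar a b = Complex ((1 + b\<^sup>2) / 2) (- a)"

lemma Re_zpar: "Re (zpar a b) > 0"
  by (simp add: zpar_def add_pos_nonneg)

text \<open>The factors on the right are the transform of \<open>hermite0\<close>, the chirp phase,
  and the transform of the test function at \<open>b * \<xi>\<close>.\<close>

lemma cgauss_zpar:
  "cgauss (zpar a b) \<xi> = complex_of_real (exp (- \<xi>\<^sup>2 / 2)) * exp (\<i> * complex_of_real (a * \<xi>\<^sup>2)) * complex_of_real (exp (- (b * \<xi>)\<^sup>2 / 2))"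
  unfolding cgauss_def exp_of_real[symmetric] exp_add[symmetric]
  by (rule arg_cong[where f=exp]) (simp add: zpar_def complex_eq_iff field_simps)

lemma chirp_hermite0_mult:
  "chirp a hermite0 \<xi> * ft hermite0 (b * \<xi>) = complex_of_real (sqrt (2 * pi)) * cgauss (zpar a b) \<xi>"
  by (simp add: chirp_def fourier_eq_ft ft_hermite0 cgauss_zpar)

text \<open>\<open>fourier\<close> evaluates \<open>ft\<close> at \<open>- \<xi>\<close>, so the
  linear factors \<open>- \<i> * \<xi>\<close> and \<open>\<i> * b * \<xi>\<close> multiply to
  \<open>b * \<xi>^2\<close> with a positive sign.\<close>

lemma chirp_hermite1_mult:
  "chirp a hermite1 \<xi> * ft hermite1 (b * \<xi>)
    = complex_of_real (sqrt (2 * pi) * b) * (complex_of_real (\<xi>\<^sup>2) * cgauss (zpar a b) \<xi>)"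
  by (simp add: chirp_def fourier_eq_ft ft_hermite1 ft_hermite0 cgauss_zpar power2_eq_square mult_ac)

lemma integral_Gpre_hermite0:
  "(\<integral>u. Gpre a b hermite0 u * hermite0 u \<partial>lborel) = complex_of_real (sqrt (2 * pi)) * (\<integral>x. cgauss (zpar a b) x \<partial>lborel)"
  by (simp only: integral_Gpre_mult schwartz_hermite schwartz_integrable chirp_hermite0_mult integral_mult_right_zero)

lemma integral_Gpre_hermite1:
  "(\<integral>u. Gpre a b hermite1 u * hermite1 u \<partial>lborel)
    = complex_of_real (sqrt (2 * pi) * b) * ((\<integral>x. cgauss (zpar a b) x \<partial>lborel) / (2 * zpar a b))"
  by (simp only: integral_Gpre_mult schwartz_hermite schwartz_integrable chirp_hermite1_mult integral_mult_right_zero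
      integral_power2_cgauss Re_zpar)

text \<open>Strong convergence implies weak convergence, by Cauchy-Schwarz.\<close>

lemma tendsto_integral_mult:
  assumes "((\<lambda>x. L2norm (\<lambda>u. g x u - h u)) \<longlongrightarrow> 0) F" "\<forall>\<^sub>F x in F. g x \<in> L2" "h \<in> L2" "\<phi> \<in> L2"
  shows "((\<lambda>x. \<integral>u. g x u * \<phi> u \<partial>lborel) \<longlongrightarrow> (\<integral>u. h u * \<phi> u \<partial>lborel)) F"
proof -
  have "((\<lambda>x. (\<integral>u. g x u * \<phi> u \<partial>lborel) - (\<integral>u. h u * \<phi> u \<partial>lborel)) \<longlongrightarrow> 0) F"
  proof (rule Lim_null_comparison)
    show "((\<lambda>x. L2norm (\<lambda>u. g x u - h u) * L2norm \<phi>) \<longlongrightarrow> 0) F"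
      using assms(1) by (rule tendsto_mult_left_zero)
    show "\<forall>\<^sub>F x in F. norm ((\<integral>u. g x u * \<phi> u \<partial>lborel) - (\<integral>u. h u * \<phi> u \<partial>lborel)) \<le> L2norm (\<lambda>u. g x u - h u) * L2norm \<phi>"
      using assms(2)
    proof eventually_elim
      case (elim x)
      have "(\<integral>u. g x u * \<phi> u \<partial>lborel) - (\<integral>u. h u * \<phi> u \<partial>lborel) = (\<integral>u. (g x u - h u) * \<phi> u \<partial>lborel)"
        using L2_mult_integrable[OF elim assms(4)] L2_mult_integrable[OF assms(3,4)] by (simp add: left_diff_distrib)
      moreover have "(cmod (\<integral>u. (g x u - h u) * \<phi> u \<partial>lborel))\<^sup>2 \<le> (L2norm (\<lambda>u. g x u - h u) * L2norm \<phi>)\<^sup>2"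
        using cmod_integral_mult_power2_le[OF L2_diff[OF elim assms(3)] assms(4)]
        by (simp add: power_mult_distrib L2norm_power2)
      ultimately show ?case
        by (auto intro: power2_le_imp_le simp: L2norm_eq_sqrt L2sq_nonneg)
    qed
  qed
  then show ?thesis by (rule LIM_zero_cancel)
qed

lemma integral_is_G_operator_mult:
  assumes T: "is_G_operator T a b" and b: "b \<noteq> 0" and f: "schwartz f" and \<phi>: "\<phi> \<in> L2"
  shows "(\<integral>u. T f u * \<phi> u \<partial>lborel) = (\<integral>u. Gpre a b f u * \<phi> u \<partial>lborel)"
proof (rule integral_cong_AE)
  have [measurable]: "T f \<in> borel_measurable borel" "Gpre a b f \<in> borel_measurable borel" "\<phi> \<in> borel_measurable borel"
    by (intro L2_measurable is_G_operator_L2[OF T] schwartz_L2 f Gpre_L2 b \<phi>)+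
  show "(\<lambda>u. T f u * \<phi> u) \<in> borel_measurable lborel" "(\<lambda>u. Gpre a b f u * \<phi> u) \<in> borel_measurable lborel"
    by measurable
  show "AE u in lborel. T f u * \<phi> u = Gpre a b f u * \<phi> u"
    using is_G_operator_schwartz[OF T f] by eventually_elim simp
qed

theorem theorem3:
  fixes I :: "real set" and \<alpha>0 :: real and A B :: "real \<Rightarrow> real"
    and G :: "real \<Rightarrow> (real \<Rightarrow> complex) \<Rightarrow> real \<Rightarrow> complex"
  assumes "is_interval I" and "\<alpha>0 \<in> I"
    and "\<forall>\<alpha>\<in>I. B \<alpha> \<noteq> 0"
    and "\<forall>\<alpha>\<in>I. is_G_operator (G \<alpha>) (A \<alpha>) (B \<alpha>)"
  shows "(\<forall>f\<in>L2. ((\<lambda>\<alpha>. L2norm (\<lambda>u. G \<alpha> f u - G \<alpha>0 f u)) \<longlongrightarrow> 0) (at \<alpha>0 within I))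
     \<longleftrightarrow> continuous (at \<alpha>0 within I) A \<and> continuous (at \<alpha>0 within I) B"
proof
  assume cont: "continuous (at \<alpha>0 within I) A \<and> continuous (at \<alpha>0 within I) B"
  show "\<forall>f\<in>L2. ((\<lambda>\<alpha>. L2norm (\<lambda>u. G \<alpha> f u - G \<alpha>0 f u)) \<longlongrightarrow> 0) (at \<alpha>0 within I)"
  proof
    fix f assume f: "f \<in> L2"
    \<comment> \<open>The limit is tested on sequences, for which the convergence results above are
      stated.\<close>
    have "((\<lambda>\<alpha>. L2sq (\<lambda>u. G \<alpha> f u - G \<alpha>0 f u)) \<longlongrightarrow> 0) (at \<alpha>0 within I)"
      unfolding tendsto_at_iff_sequentially
    proof (intro allI impI)
      fix X :: "nat \<Rightarrow> real" assume X: "\<forall>i. X i \<in> I - {\<alpha>0}" "X \<longlonglongrightarrow> \<alpha>0"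
      have "(\<lambda>n. A (X n)) \<longlonglongrightarrow> A \<alpha>0" "(\<lambda>n. B (X n)) \<longlonglongrightarrow> B \<alpha>0"
        using cont X unfolding continuous_within tendsto_at_iff_sequentially comp_def by blast+
      moreover have "X n \<in> I" for n using X by blast
      ultimately have "(\<lambda>n. L2sq (\<lambda>u. G (X n) f u - G \<alpha>0 f u)) \<longlonglongrightarrow> 0"
        using assms f by (intro is_G_operator_tendsto[of "\<lambda>n. G (X n)" "\<lambda>n. A (X n)" "\<lambda>n. B (X n)" "G \<alpha>0" "A \<alpha>0" "B \<alpha>0"]) auto
      then show "((\<lambda>\<alpha>. L2sq (\<lambda>u. G \<alpha> f u - G \<alpha>0 f u)) \<circ> X) \<longlonglongrightarrow> 0"
        by (simp add: comp_def)
    qed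
    then show "((\<lambda>\<alpha>. L2norm (\<lambda>u. G \<alpha> f u - G \<alpha>0 f u)) \<longlongrightarrow> 0) (at \<alpha>0 within I)"
      by (simp add: L2norm_tendsto_0_iff)
  qed
next
  assume conv: "\<forall>f\<in>L2. ((\<lambda>\<alpha>. L2norm (\<lambda>u. G \<alpha> f u - G \<alpha>0 f u)) \<longlongrightarrow> 0) (at \<alpha>0 within I)"
  have ev: "\<forall>\<^sub>F \<alpha> in at \<alpha>0 within I. \<alpha> \<in> I"
    by (simp add: eventually_at_filter)
  \<comment> \<open>The test function is \<open>f\<close> itself, and the integral does not see the
    null set where \<open>G \<alpha> f\<close> and \<open>Gpre\<close> differ.\<close>
  have pair: "((\<lambda>\<alpha>. \<integral>u. Gpre (A \<alpha>) (B \<alpha>) f u * f u \<partial>lborel) \<longlongrightarrow> (\<integral>u. Gpre (A \<alpha>0) (B \<alpha>0) f u * f u \<partial>lborel)) (at \<alpha>0 within I)"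
    if f: "schwartz f" for f
  proof -
    have L2: "G \<alpha> f \<in> L2" if "\<alpha> \<in> I" for \<alpha>
      using assms(4) that schwartz_L2[OF f] by (auto simp: is_G_operator_def)
    have eq: "(\<integral>u. G \<alpha> f u * f u \<partial>lborel) = (\<integral>u. Gpre (A \<alpha>) (B \<alpha>) f u * f u \<partial>lborel)" if "\<alpha> \<in> I" for \<alpha>
      using assms(3,4) that by (intro integral_is_G_operator_mult f schwartz_L2[OF f]) auto
    have "((\<lambda>\<alpha>. \<integral>u. G \<alpha> f u * f u \<partial>lborel) \<longlongrightarrow> (\<integral>u. G \<alpha>0 f u * f u \<partial>lborel)) (at \<alpha>0 within I)"
      using conv assms(2) by (intro tendsto_integral_mult schwartz_L2[OF f] L2 eventually_mono[OF ev]) (auto simp: schwartz_L2[OF f])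
    moreover have "\<forall>\<^sub>F \<alpha> in at \<alpha>0 within I. (\<integral>u. G \<alpha> f u * f u \<partial>lborel) = (\<integral>u. Gpre (A \<alpha>) (B \<alpha>) f u * f u \<partial>lborel)"
      using ev by eventually_elim (rule eq)
    ultimately show ?thesis
      unfolding eq[OF assms(2)] by (rule Lim_transform_eventually)
  qed
  define z where "z \<alpha> = zpar (A \<alpha>) (B \<alpha>)" for \<alpha>
  define F where "F \<alpha> = (\<integral>x. cgauss (z \<alpha>) x \<partial>lborel)" for \<alpha>
  have z0: "z \<alpha> \<noteq> 0" for \<alpha> using Re_zpar[of "A \<alpha>" "B \<alpha>"] by (auto simp: z_def)
  have F2: "(F \<alpha>)\<^sup>2 = complex_of_real pi / z \<alpha>" for \<alpha>
    unfolding F_def z_def by (rule integral_cgauss_power2[OF Re_zpar])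
  have F0: "F \<alpha> \<noteq> 0" for \<alpha> using F2[of \<alpha>] z0[of \<alpha>] by auto
  have s: "complex_of_real (sqrt (2 * pi)) \<noteq> 0" by simp
  have limF: "(F \<longlongrightarrow> F \<alpha>0) (at \<alpha>0 within I)"
  proof -
    have "((\<lambda>\<alpha>. complex_of_real (sqrt (2 * pi)) * F \<alpha> / complex_of_real (sqrt (2 * pi))) \<longlongrightarrow>
        complex_of_real (sqrt (2 * pi)) * F \<alpha>0 / complex_of_real (sqrt (2 * pi))) (at \<alpha>0 within I)"
      using pair[OF schwartz_hermite(1)] unfolding integral_Gpre_hermite0 z_def[symmetric] F_def[symmetric]
      by (intro tendsto_divide tendsto_const s)
    then show ?thesis by simp
  qed
  \<comment> \<open>\<open>F\<close> determines \<open>z\<close> as \<open>pi / F^2\<close>, so no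
    branch of the complex square root enters.\<close>
  have limz: "(z \<longlongrightarrow> z \<alpha>0) (at \<alpha>0 within I)"
  proof -
    have "((\<lambda>\<alpha>. complex_of_real pi / (F \<alpha>)\<^sup>2) \<longlongrightarrow> complex_of_real pi / (F \<alpha>0)\<^sup>2) (at \<alpha>0 within I)"
      using F0 by (intro tendsto_intros limF) simp
    then show ?thesis using z0 by (simp add: F2)
  qed
  \<comment> \<open>In the pairing with \<open>hermite1\<close> everything but \<open>B\<close> is
    already known to converge to a nonzero limit and can be divided out; this recovers
    \<open>B\<close> with its sign.\<close>
  have limB: "((\<lambda>\<alpha>. complex_of_real (B \<alpha>)) \<longlongrightarrow> complex_of_real (B \<alpha>0)) (at \<alpha>0 within I)"
  proof -
    note pair1 = pair[OF schwartz_hermite(2), unfolded integral_Gpre_hermite1, folded z_def, folded F_def]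
    have "((\<lambda>\<alpha>. complex_of_real (sqrt (2 * pi) * B \<alpha>) * (F \<alpha> / (2 * z \<alpha>)) * (2 * z \<alpha>) / (complex_of_real (sqrt (2 * pi)) * F \<alpha>))
        \<longlongrightarrow> complex_of_real (sqrt (2 * pi) * B \<alpha>0) * (F \<alpha>0 / (2 * z \<alpha>0)) * (2 * z \<alpha>0) / (complex_of_real (sqrt (2 * pi)) * F \<alpha>0)) (at \<alpha>0 within I)"
      using F0 by (intro tendsto_divide tendsto_mult[OF pair1] tendsto_intros limF limz) simp
    then show ?thesis using F0 z0 by simp
  qed
  \<comment> \<open>\<open>A\<close> is minus the imaginary part of \<open>z\<close>.\<close>
  have "(A \<longlongrightarrow> A \<alpha>0) (at \<alpha>0 within I)"
    using tendsto_minus[OF tendsto_Im[OF limz]] by (simp add: z_def zpar_def)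
  moreover have "(B \<longlongrightarrow> B \<alpha>0) (at \<alpha>0 within I)"
    using tendsto_Re[OF limB] by simp
  ultimately show "continuous (at \<alpha>0 within I) A \<and> continuous (at \<alpha>0 within I) B"
    by (simp add: continuous_within)
qed

end
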